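(* For every admissible $(z,z')$, the spectral $z$-measure $P_{zz'}$ is concentrated on the face $\Omega_0=\{(\alpha,\beta,\gamma)\in\Omega:\gamma=0\}$ of the Thoma simplex, i.e. $P_{zz'}(\Omega_0)=1$. Equivalently, the first controlling measure $\sigma^{(zz')}_1$ has no atom at $0$.
   Context: Thoma simplex $\Omega$: triples $\omega=(\alpha,\beta,\gamma)$ with $\alpha_1\ge\alpha_2\ge\dots\ge0$, $\beta_1\ge\dots\ge0$, $\gamma\ge0$, $\sum(\alpha_i+\beta_i)+\gamma=1$, with the weakest topology making all $\alpha_i,\beta_i$ continuous. Extended power sums $\tilde p_1\equiv1$, $\tilde p_n=\sum\alpha_i^n+(-1)^{n-1}\sum\beta_i^n$ ($n\ge2$); $\tilde s_\lambda$ is the Schur function $s_\lambda$ written as a polynomial in power sums $p_n$ with $p_n$ replaced by $\tilde p_n$. $\dim\lambda$ = number of standard Young tableaux of shape $\lambda$. Admissible parameters: either $z'=\bar z$, $z\notin\mathbb Z$, or $z,z'$ real in a common interval $(m,m+1)$, $m\in\mathbb Z$; $t=zz'$. $M_{zz'}(\lambda)=\frac{\prod_{(i,j)\in\lambda}(z+j-i)(z'+j-i)}{(t)_{|\lambda|}}\frac{(\dim\lambda)^2}{|\lambda|!}$, and $P_{zz'}$ is the unique Borel probability measure on $\Omega$ with $M_{zz'}(\lambda)/\dim\lambda=\int\tilde s_\lambda\,dP_{zz'}$ for all $\lambda$. $\sigma^{(zz')}_1=\int_\Omega\nu^{(\omega)}P_{zz'}(d\omega)$ with $\nu^{(\omega)}=\sum\alpha_i\delta(\alpha_i)+\sum\beta_i\delta(-\beta_i)+\gamma\delta(0)$.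 *)

theory Defs
  imports "HOL-Analysis.Analysis" "HOL-Probability.Probability" "HOL-Combinatorics.Permutations"
begin

type_synonym thoma = "(nat \<Rightarrow> real) \<times> (nat \<Rightarrow> real) \<times> real"

definition th_alpha :: "thoma \<Rightarrow> nat \<Rightarrow> real" where "th_alpha \<omega> = fst \<omega>"
definition th_beta :: "thoma \<Rightarrow> nat \<Rightarrow> real" where "th_beta \<omega> = fst (snd \<omega>)"
definition th_gamma :: "thoma \<Rightarrow> real" where "th_gamma \<omega> = snd (snd \<omega>)"

definition Thoma_simplex :: "thoma set" where
  "Thoma_simplex = {\<omega>.
      (\<forall>i. th_alpha \<omega> (Suc i) \<le> th_alpha \<omega> i) \<and> (\<forall>i. 0 \<le> th_alpha \<omega> i) \<and>
      (\<forall>i. th_beta \<omega> (Suc i) \<le> th_beta \<omega> i) \<and> (\<forall>i. 0 \<le> th_beta \<omega> i) \<and>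
      0 \<le> th_gamma \<omega> \<and>
      ((\<lambda>i. th_alpha \<omega> i + th_beta \<omega> i) sums (1 - th_gamma \<omega>))}"

definition Thoma_face0 :: "thoma set" where
  "Thoma_face0 = {\<omega> \<in> Thoma_simplex. th_gamma \<omega> = 0}"

text \<open>Weakest topology on the simplex making all alpha_i, beta_i continuous:
  pullback of the product topology on (nat => real) x (nat => real).\<close>
definition Thoma_topology :: "thoma topology" where
  "Thoma_topology = pullback_topology Thoma_simplex (\<lambda>\<omega>. (th_alpha \<omega>, th_beta \<omega>)) euclidean"

definition Thoma_borel :: "thoma measure" where
  "Thoma_borel = sigma (topspace Thoma_topology) {U. openin Thoma_topology U}"

definition is_partition :: "nat list \<Rightarrow> bool" where
  "is_partition lam \<longleftrightarrow> sorted_wrt (\<ge>) lam \<and> 0 \<notin> set lam"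

definition partitions_of :: "nat \<Rightarrow> nat list set" where
  "partitions_of n = {\<rho>. is_partition \<rho> \<and> sum_list \<rho> = n}"

definition z_part :: "nat list \<Rightarrow> nat" where
  "z_part \<rho> = (\<Prod>i\<in>set \<rho>. i ^ count_list \<rho> i * fact (count_list \<rho> i))"

definition ptilde :: "nat \<Rightarrow> thoma \<Rightarrow> real" where
  "ptilde n \<omega> = (if n = 1 then 1 else
     (\<Sum>i. th_alpha \<omega> i ^ n) + (-1) ^ (n - 1) * (\<Sum>i. th_beta \<omega> i ^ n))"

text \<open>Complete homogeneous symmetric function h_n = sum over partitions rho of n of p_rho / z_rho,
  with p_n replaced by ptilde n.\<close>
definition htilde :: "nat \<Rightarrow> thoma \<Rightarrow> real" where
  "htilde n \<omega> = (\<Sum>\<rho>\<in>partitions_of n. prod_list (map (\<lambda>k. ptilde k \<omega>) \<rho>) / real (z_part \<rho>))"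

definition htilde_int :: "int \<Rightarrow> thoma \<Rightarrow> real" where
  "htilde_int k \<omega> = (if k < 0 then 0 else htilde (nat k) \<omega>)"

text \<open>Schur function via the Jacobi--Trudi determinant s_lambda = det[h_(lambda_i - i + j)],
  specialized at omega.\<close>
definition stilde :: "nat list \<Rightarrow> thoma \<Rightarrow> real" where
  "stilde lam \<omega> = (\<Sum>\<sigma> | \<sigma> permutes {..<length lam}.
      of_int (sign \<sigma>) * (\<Prod>i<length lam. htilde_int (int (lam ! i) - int i + int (\<sigma> i)) \<omega>))"

definition cells :: "nat list \<Rightarrow> (nat \<times> nat) set" where
  "cells lam = {(i, j). i < length lam \<and> j < lam ! i}"

definition dim_part :: "nat list \<Rightarrow> nat" where
  "dim_part lam = card {f. f \<in> cells lam \<rightarrow>\<^sub>E {1..sum_list lam} \<and>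
      bij_betw f (cells lam) {1..sum_list lam} \<and>
      (\<forall>i j. (i, j + 1) \<in> cells lam \<longrightarrow> f (i, j) < f (i, j + 1)) \<and>
      (\<forall>i j. (i + 1, j) \<in> cells lam \<longrightarrow> f (i, j) < f (i + 1, j))}"

definition admissible :: "complex \<Rightarrow> complex \<Rightarrow> bool" where
  "admissible z z' \<longleftrightarrow>
     (z' = cnj z \<and> z \<notin> \<int>) \<or>
     (z \<in> \<real> \<and> z' \<in> \<real> \<and> (\<exists>m::int. m < Re z \<and> Re z < m + 1 \<and> m < Re z' \<and> Re z' < m + 1))"

definition Mzz :: "complex \<Rightarrow> complex \<Rightarrow> nat list \<Rightarrow> complex" where
  "Mzz z z' lam =
     (\<Prod>(i, j)\<in>cells lam. (z + of_int (int j - int i)) * (z' + of_int (int j - int i)))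
       / pochhammer (z * z') (sum_list lam)
     * (of_nat (dim_part lam))\<^sup>2 / of_nat (fact (sum_list lam))"

end

theory Submission
  imports
    Defs
    "HOL-Library.Multiset"
    "HOL-Computational_Algebra.Formal_Power_Series"
    "Jordan_Normal_Form.Determinant"
begin

text \<open>
  The mean of \<open>ptilde n\<close> is the moment of degree \<open>n - 1\<close> of the first controlling measure \<open>\<sigma>\<close>. Expanding
  the power sum as the alternating sum of hook Schur functions makes it an explicit hypergeometric
  sum, and with \<open>t = z z'\<close>, \<open>s = z + z'\<close>, \<open>d = z - z'\<close> these moments \<open>m k\<close> satisfy

  \<open>(k+3)(t+k+1)(t+k) m (k+1) - s(2k+3)(t+k) m k - k((k+1)\<^sup>2-d\<^sup>2) m (k-1) = 0\<close>.

  Hence \<open>\<sigma>\<close> annihilates \<open>L f\<close> for every polynomial \<open>f\<close>, where \<open>L\<close> is the third-order differential operator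
  that sends \<open>x\<^sup>k\<close> to the combination above with each \<open>m i\<close> replaced by \<open>x\<^sup>i\<close>. For \<open>f = x(1-x\<^sup>2)\<^sup>N\<close> the functions
  \<open>L f\<close> are uniformly bounded on \<open>[-1, 1]\<close> and tend to 0 off the origin, while \<open>(L f)(0) = -(4-d\<^sup>2)\<close>. By
  dominated convergence \<open>(4-d\<^sup>2) \<sigma>{0} = 0\<close>, and admissibility forces \<open>d\<^sup>2 < 1\<close>; so the mean \<open>\<sigma>{0}\<close> of \<open>\<gamma>\<close> vanishes.
\<close>

section \<open>A recurrence for the hook sums\<close>

text \<open>The unnormalised mean of \<open>ptilde n\<close>: the term with index \<open>j\<close>
  belongs to the hook with leg length \<open>j\<close>, whose number of standard tableaux is the
  binomial coefficient.\<close>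

definition hook_sum :: "'a::field_char_0 \<Rightarrow> 'a \<Rightarrow> nat \<Rightarrow> 'a" where
  "hook_sum z w n = (\<Sum>j<n. (-1) ^ j * of_nat ((n - 1) choose j) *
      pochhammer (z - of_nat j) n * pochhammer (w - of_nat j) n)"

lemma pochhammer_Suc_shift:
  fixes x :: "'a::field_char_0"
  shows "pochhammer (x - 1) (Suc k) = (x - 1) * pochhammer x k"
  by (simp add: pochhammer_rec)

text \<open>The recurrence and the certificate \<open>\<rho>\<close>, which makes the combined summand the difference
  \<open>G (Suc j) - G j\<close>, come from Zeilberger's algorithm.\<close>

lemma hook_sum_recurrence:
  fixes z w :: "'a::field_char_0" and k :: nat
  defines "K \<equiv> of_nat k :: 'a"
  shows "(K + 3) * hook_sum z w (k + 2) =
    (z + w) * (2 * K + 3) * (K + 2) * hook_sum z w (k + 1) +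
    K * (K + 1) * (K + 2) * ((K + 1)\<^sup>2 - (z - w)\<^sup>2) * hook_sum z w k"
proof -
  \<comment> \<open>The largest factor common to the three sums: Pochhammer symbols of the shortest
    length \<open>k\<close>, binomials from the longest sum. Each summand becomes \<open>X j\<close>
    times a polynomial in \<open>j\<close>.\<close>
  define X where "X j = (-1) ^ j * of_nat ((k + 1) choose j) *
    pochhammer (z - of_nat j) k * pochhammer (w - of_nat j) k" for j
  define \<rho> where "\<rho> J = (K + 1) * J\<^sup>2 - ((3 * K + 4) * (K + 1) - (z + w)) * J
    - (K + 3) * z * w + (K + 1)\<^sup>2 * (2 * K + 3) - (z + w) * (K + 1)" for J
  define G where "G j = (-1) ^ j * of_nat ((k + 1) choose j) * of_nat j * \<rho> (of_nat j) *
    pochhammer (z - of_nat j) (Suc k) * pochhammer (w - of_nat j) (Suc k)" for j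
  have K1: "K + 1 \<noteq> 0"
    using of_nat_neq_0[of k, where ?'a = 'a] by (simp_all add: K_def add.commute)
  have G_eq: "G j = X j * (of_nat j * \<rho> (of_nat j) * (z - of_nat j + K) * (w - of_nat j + K))" for j
    by (simp add: G_def X_def pochhammer_Suc K_def algebra_simps)
  have G_Suc: "G (Suc j) = - X j * ((K + 1 - of_nat j) * \<rho> (of_nat j + 1) *
      (z - of_nat j - 1) * (w - of_nat j - 1))" for j
  proof -
    have "of_nat (Suc j * ((k + 1) choose Suc j)) = (of_nat (((k + 1) - j) * ((k + 1) choose j)) :: 'a)"
      by (simp only: binomial_absorb_comp[of "k + 1" j] binomial_absorption[of j "k + 1"])
    also have "\<dots> = (K + 1 - of_nat j) * of_nat ((k + 1) choose j)"
      by (cases "j \<le> k + 1") (simp_all add: K_def of_nat_diff binomial_eq_0)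
    finally have b: "of_nat (Suc j) * of_nat ((k + 1) choose Suc j) =
        (K + 1 - of_nat j) * (of_nat ((k + 1) choose j) :: 'a)"
      by (simp only: of_nat_mult)
    have "G (Suc j) = - ((-1) ^ j) * (of_nat (Suc j) * of_nat ((k + 1) choose Suc j)) * \<rho> (of_nat j + 1) *
      pochhammer (z - of_nat j - 1) (Suc k) * pochhammer (w - of_nat j - 1) (Suc k)"
      unfolding G_def by (simp add: algebra_simps)
    also have "\<dots> = - X j * ((K + 1 - of_nat j) * \<rho> (of_nat j + 1) *
      (z - of_nat j - 1) * (w - of_nat j - 1))"
      unfolding b pochhammer_Suc_shift X_def by (simp add: algebra_simps)
    finally show ?thesis .
  qed
  \<comment> \<open>Both ends vanish: \<open>G 0\<close> contains the factor 0, and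
    \<open>G (k + 2)\<close> the binomial coefficient of \<open>k + 2\<close> out of
    \<open>k + 1\<close>.\<close>
  have tele: "(\<Sum>j<k + 2. G (Suc j) - G j) = 0"
    by (simp only: sum_lessThan_telescope) (simp add: G_def binomial_eq_0)
  have s2: "hook_sum z w (k + 2) = (\<Sum>j<k + 2. X j * ((z - of_nat j + K) * (z - of_nat j + K + 1) *
      (w - of_nat j + K) * (w - of_nat j + K + 1)))"
    unfolding hook_sum_def X_def K_def
    by (intro sum.cong) (simp_all add: pochhammer_Suc algebra_simps)
  \<comment> \<open>The factor \<open>K + 1\<close> pays for raising the upper binomial index from
    \<open>k\<close> to \<open>k + 1\<close>. The additional term \<open>j = k + 1\<close> contains
    \<open>K + 1 - j = 0\<close>, so the range may be extended.\<close>
  have s1: "(K + 1) * hook_sum z w (k + 1) = (\<Sum>j<k + 2. X j * ((K + 1 - of_nat j) *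
      (z - of_nat j + K) * (w - of_nat j + K)))"
  proof -
    have "(K + 1) * of_nat (k choose j) = (K + 1 - of_nat j) * (of_nat ((k + 1) choose j) :: 'a)" if "j \<le> k" for j
    proof -
      have "of_nat ((k + 1) * (k choose j)) = (of_nat ((k + 1 - j) * ((k + 1) choose j)) :: 'a)"
        using binomial_absorb_comp[of "k + 1" j] by simp
      thus ?thesis using that unfolding of_nat_mult K_def by (simp add: of_nat_diff add.commute)
    qed
    note b = this
    have "(K + 1) * hook_sum z w (k + 1) = (\<Sum>j<k + 1. (-1) ^ j * ((K + 1) * of_nat (k choose j)) *
        pochhammer (z - of_nat j) (Suc k) * pochhammer (w - of_nat j) (Suc k))"
      unfolding hook_sum_def sum_distrib_left by (intro sum.cong) (simp_all add: algebra_simps)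
    also have "\<dots> = (\<Sum>j<k + 1. X j * ((K + 1 - of_nat j) * (z - of_nat j + K) * (w - of_nat j + K)))"
    proof (intro sum.cong refl)
      fix j assume "j \<in> {..<k + 1}"
      hence j: "j \<le> k" by simp
      show "(-1) ^ j * ((K + 1) * of_nat (k choose j)) * pochhammer (z - of_nat j) (Suc k) *
          pochhammer (w - of_nat j) (Suc k) =
        X j * ((K + 1 - of_nat j) * (z - of_nat j + K) * (w - of_nat j + K))"
        unfolding b[OF j] unfolding X_def pochhammer_Suc K_def[symmetric] by (simp only: mult_ac)
    qed
    finally show ?thesis by (simp add: K_def)
  qed
  \<comment> \<open>Here the upper index rises twice, and both additional terms,
    \<open>j = k\<close> and \<open>j = k + 1\<close>, vanish.\<close>
  have s0: "K * (K + 1) * hook_sum z w k = (\<Sum>j<k + 2. X j * ((K + 1 - of_nat j) * (K - of_nat j)))"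
  proof -
    have b: "K * (K + 1) * of_nat ((k - 1) choose j) =
        (K + 1 - of_nat j) * (K - of_nat j) * (of_nat ((k + 1) choose j) :: 'a)" if "j < k" for j
    proof -
      have "of_nat ((k + 1) * (k choose j)) = (of_nat ((k + 1 - j) * ((k + 1) choose j)) :: 'a)"
        using binomial_absorb_comp[of "k + 1" j] by simp
      hence 1: "(K + 1) * of_nat (k choose j) = (K + 1 - of_nat j) * (of_nat ((k + 1) choose j) :: 'a)"
        using that unfolding of_nat_mult K_def by (simp add: of_nat_diff add.commute)
      have "of_nat (k * ((k - 1) choose j)) = (of_nat ((k - j) * (k choose j)) :: 'a)"
        using binomial_absorb_comp[of "k" j] by simp
      hence 2: "K * of_nat ((k - 1) choose j) = (K - of_nat j) * (of_nat (k choose j) :: 'a)"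
        using that unfolding of_nat_mult K_def by (simp add: of_nat_diff add.commute)
      show ?thesis using 1 2 by Groebner_Basis.algebra
    qed
    have "K * (K + 1) * hook_sum z w k = (\<Sum>j<k. (-1) ^ j * (K * (K + 1) * of_nat ((k - 1) choose j)) *
        pochhammer (z - of_nat j) k * pochhammer (w - of_nat j) k)"
      unfolding hook_sum_def sum_distrib_left by (intro sum.cong) (simp_all add: algebra_simps)
    also have "\<dots> = (\<Sum>j<k. X j * ((K + 1 - of_nat j) * (K - of_nat j)))"
    proof (intro sum.cong refl)
      fix j assume "j \<in> {..<k}"
      hence j: "j < k" by simp
      show "(-1) ^ j * (K * (K + 1) * of_nat ((k - 1) choose j)) * pochhammer (z - of_nat j) k *
          pochhammer (w - of_nat j) k = X j * ((K + 1 - of_nat j) * (K - of_nat j))"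
        unfolding b[OF j] unfolding X_def by (simp only: mult_ac)
    qed
    finally show ?thesis by (simp add: K_def)
  qed
  \<comment> \<open>The common prefactor \<open>K + 1\<close> brings the sums into the forms
    \<open>s1\<close> and \<open>s0\<close>; it is nonzero in characteristic 0 and is cancelled at
    the end.\<close>
  have "(K + 1) * ((K + 3) * hook_sum z w (k + 2)
      - (z + w) * (2 * K + 3) * (K + 2) * hook_sum z w (k + 1)
      - K * (K + 1) * (K + 2) * ((K + 1)\<^sup>2 - (z - w)\<^sup>2) * hook_sum z w k) =
      (K + 1) * (K + 3) * hook_sum z w (k + 2)
      - (z + w) * (2 * K + 3) * (K + 2) * ((K + 1) * hook_sum z w (k + 1))
      - (K + 1) * (K + 2) * ((K + 1)\<^sup>2 - (z - w)\<^sup>2) * (K * (K + 1) * hook_sum z w k)"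
    by (simp add: algebra_simps)
  also have "\<dots> = (\<Sum>j<k + 2. G (Suc j) - G j)"
    unfolding s2 s1 s0 sum_distrib_left sum_subtractf[symmetric]
  proof (intro sum.cong refl)
    fix j
    show "(K + 1) * (K + 3) * (X j * ((z - of_nat j + K) * (z - of_nat j + K + 1) *
      (w - of_nat j + K) * (w - of_nat j + K + 1))) -
      (z + w) * (2 * K + 3) * (K + 2) * (X j * ((K + 1 - of_nat j) * (z - of_nat j + K) * (w - of_nat j + K))) -
      (K + 1) * (K + 2) * ((K + 1)\<^sup>2 - (z - w)\<^sup>2) * (X j * ((K + 1 - of_nat j) * (K - of_nat j))) =
      G (Suc j) - G j"
      unfolding G_Suc unfolding G_eq \<rho>_def by Groebner_Basis.algebra
  qed
  also note tele
  finally have "(K + 3) * hook_sum z w (k + 2)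
      - (z + w) * (2 * K + 3) * (K + 2) * hook_sum z w (k + 1)
      - K * (K + 1) * (K + 2) * ((K + 1)\<^sup>2 - (z - w)\<^sup>2) * hook_sum z w k = 0"
    using K1 by (simp only: mult_eq_0_iff simp_thms)
  thus ?thesis by Groebner_Basis.algebra
qed

text \<open>Dividing by the denominator of \<open>Mzz\<close> at size \<open>n\<close> turns hook
  sums into means of power sums. With \<open>q (k + 1)\<close> read as the moment of degree
  \<open>k\<close>, this is the moment recurrence behind the operator L.\<close>

lemma hook_mean_recurrence:
  fixes z w :: "'a::field_char_0" and k :: nat
  assumes t: "\<And>n. pochhammer (z * w) n \<noteq> 0"
  defines "K \<equiv> of_nat k :: 'a" and "q \<equiv> \<lambda>n. hook_sum z w n / (pochhammer (z * w) n * fact n)"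
  shows "(K + 3) * (z * w + K + 1) * (z * w + K) * q (k + 2) =
    (z + w) * (2 * K + 3) * (z * w + K) * q (k + 1) +
    K * ((K + 1)\<^sup>2 - (z - w)\<^sup>2) * q k"
proof -
  have p: "pochhammer (z * w) (k + 1) = pochhammer (z * w) k * (z * w + K)"
    "pochhammer (z * w) (k + 2) = pochhammer (z * w) k * (z * w + K) * (z * w + K + 1)"
    by (simp_all add: pochhammer_Suc K_def algebra_simps)
  have f: "fact (k + 1) = (K + 1) * fact k" "fact (k + 2) = (K + 2) * ((K + 1) * fact k)"
    by (simp_all add: K_def algebra_simps)
  have nz: "pochhammer (z * w) k \<noteq> 0" "z * w + K \<noteq> 0" "z * w + K + 1 \<noteq> 0"
    using t[of k] t[of "k+2"] unfolding p by auto
  have K: "K + 1 \<noteq> 0" "K + 2 \<noteq> 0" "(fact k :: 'a) \<noteq> 0"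
    using of_nat_neq_0[of k, where ?'a = 'a] of_nat_neq_0[of "Suc k", where ?'a = 'a]
    by (simp_all add: K_def add.commute)
  have "(K + 3) * (z * w + K + 1) * (z * w + K) * q (k + 2) =
     (K + 3) * hook_sum z w (k + 2) / (pochhammer (z * w) k * fact k * (K + 1) * (K + 2))"
    unfolding q_def p f using nz K by (simp add: divide_simps)
  also have "\<dots> = ((z + w) * (2 * K + 3) * (K + 2) * hook_sum z w (k + 1) +
    K * (K + 1) * (K + 2) * ((K + 1)\<^sup>2 - (z - w)\<^sup>2) * hook_sum z w k) /
     (pochhammer (z * w) k * fact k * (K + 1) * (K + 2))"
    using hook_sum_recurrence[of k z w] unfolding K_def by simp
  also have "\<dots> = (z + w) * (2 * K + 3) * hook_sum z w (k + 1) / (pochhammer (z * w) k * fact k * (K + 1)) +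
     K * ((K + 1)\<^sup>2 - (z - w)\<^sup>2) * hook_sum z w k / (pochhammer (z * w) k * fact k)"
    using nz K by (simp add: divide_simps) Groebner_Basis.algebra
  also have "\<dots> = (z + w) * (2 * K + 3) * (z * w + K) * q (k + 1) +
    K * ((K + 1)\<^sup>2 - (z - w)\<^sup>2) * q k"
    unfolding q_def p f using nz K by (simp add: divide_simps)
  finally show ?thesis .
qed

section \<open>Power sums and hook Schur functions\<close>

definition partition_msets :: "nat \<Rightarrow> nat multiset set" where
  "partition_msets n = {M. 0 \<notin># M \<and> sum_mset M = n}"

definition z_mset :: "nat multiset \<Rightarrow> nat" where
  "z_mset M = (\<Prod>i\<in>set_mset M. i ^ count M i * fact (count M i))"

text \<open>On multisets, adding or removing a part needs no re-sorting; this bijection transports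
  the sum in \<open>htilde\<close> to them.\<close>

lemma bij_betw_mset_partitions_of: "bij_betw mset (partitions_of n) (partition_msets n)"
proof (rule bij_betw_byWitness[where f' = "\<lambda>M. rev (sorted_list_of_multiset M)"])
  have rev_sorted: "sorted (rev xs)" if "is_partition xs" for xs
    using that by (simp add: is_partition_def sorted_wrt_rev)
  show "\<forall>xs\<in>partitions_of n. rev (sorted_list_of_multiset (mset xs)) = xs"
  proof
    fix xs assume "xs \<in> partitions_of n"
    hence "sorted (rev xs)" using rev_sorted by (simp add: partitions_of_def)
    hence "sort xs = rev xs" by (intro properties_for_sort) simp_all
    thus "rev (sorted_list_of_multiset (mset xs)) = xs"
      by (simp add: sorted_list_of_multiset_mset)
  qed
  show "\<forall>M\<in>partition_msets n. mset (rev (sorted_list_of_multiset M)) = M"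
    by simp
  show "mset ` partitions_of n \<subseteq> partition_msets n"
    by (auto simp: partitions_of_def partition_msets_def is_partition_def sum_mset_sum_list)
  show "(\<lambda>M. rev (sorted_list_of_multiset M)) ` partition_msets n \<subseteq> partitions_of n"
  proof
    fix xs assume "xs \<in> (\<lambda>M. rev (sorted_list_of_multiset M)) ` partition_msets n"
    then obtain M where M: "M \<in> partition_msets n" and xs: "xs = rev (sorted_list_of_multiset M)"
      by blast
    have "mset xs = M" by (simp add: xs)
    moreover have "sum_list xs = sum_mset (mset xs)" by (simp add: sum_mset_sum_list)
    ultimately show "xs \<in> partitions_of n"
      using M by (auto simp: partitions_of_def partition_msets_def is_partition_def xs
          sorted_wrt_rev sorted_sorted_list_of_multiset)
  qed
qed

lemma length_le_sum_list:
  fixes xs :: "nat list"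
  assumes "0 \<notin> set xs"
  shows "length xs \<le> sum_list xs"
  using assms by (induction xs) (auto simp: Suc_le_eq)

lemma finite_partitions_of: "finite (partitions_of n)"
proof (rule finite_subset)
  show "partitions_of n \<subseteq> {xs. set xs \<subseteq> {..n} \<and> length xs \<le> n}"
    using length_le_sum_list member_le_sum_list
    by (fastforce simp: partitions_of_def is_partition_def)
qed (simp add: finite_lists_length_le)

lemma finite_partition_msets: "finite (partition_msets n)"
  using bij_betw_finite[OF bij_betw_mset_partitions_of] finite_partitions_of by blast

lemma z_mset_superset:
  assumes "finite A" "set_mset M \<subseteq> A"
  shows "z_mset M = (\<Prod>i\<in>A. i ^ count M i * fact (count M i))"
  unfolding z_mset_def by (rule prod.mono_neutral_left) (use assms in \<open>auto simp: not_in_iff\<close>)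

text \<open>Only the factor of the part \<open>k\<close> changes: its power gains one
  \<open>k\<close> and its factorial gains the new multiplicity.\<close>

lemma z_mset_add_mset: "z_mset (add_mset k M) = k * Suc (count M k) * z_mset M"
proof -
  define A where "A = insert k (set_mset M)"
  have A: "finite A" "k \<in> A" by (simp_all add: A_def)
  have "z_mset (add_mset k M) = (\<Prod>i\<in>A. i ^ count (add_mset k M) i * fact (count (add_mset k M) i))"
    by (rule z_mset_superset) (auto simp: A_def)
  also have "\<dots> = (k * Suc (count M k)) * (k ^ count M k * fact (count M k)) *
      (\<Prod>i\<in>A - {k}. i ^ count M i * fact (count M i))"
    by (simp add: prod.remove[OF A] fact_Suc algebra_simps del: mult_Suc mult_Suc_right)
  also have "\<dots> = (k * Suc (count M k)) * (\<Prod>i\<in>A. i ^ count M i * fact (count M i))"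
    by (simp only: prod.remove[OF A] mult.assoc)
  also have "(\<Prod>i\<in>A. i ^ count M i * fact (count M i)) = z_mset M"
    by (rule z_mset_superset[symmetric]) (auto simp: A_def)
  finally show ?thesis .
qed

lemma z_mset_pos: "0 \<notin># M \<Longrightarrow> z_mset M > 0"
  unfolding z_mset_def by (rule prod_pos) (auto intro!: Nat.gr0I)

lemma sum_mset_eq_sum_count: "sum_mset M = (\<Sum>k\<in>set_mset M. count M k * (k::nat))"
proof -
  have "sum_mset M = (\<Sum>k\<in>A. count M k * k)" if "finite A" "set_mset M \<subseteq> A" for A
    using that
  proof (induction M)
    case (add x M)
    have "(\<Sum>k\<in>A. count (add_mset x M) k * k) = (\<Sum>k\<in>A. count M k * k + (if k = x then k else 0))"
      by (intro sum.cong) auto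
    also have "\<dots> = (\<Sum>k\<in>A. count M k * k) + x"
      using add.prems by (simp add: sum.distrib)
    finally show ?case using add by simp
  qed simp
  thus ?thesis by blast
qed

text \<open>The cycle index of the symmetric group on \<open>n\<close> letters in arbitrary
  variables \<open>p k\<close>. Identities proved for it survive the specialisation to
  \<open>ptilde\<close>, including the value 1 of \<open>ptilde 1\<close>.\<close>

definition cycle_h :: "(nat \<Rightarrow> real) \<Rightarrow> nat \<Rightarrow> real" where
  "cycle_h p n = (\<Sum>M\<in>partition_msets n. prod_mset (image_mset p M) / real (z_mset M))"

lemma htilde_eq_cycle_h: "htilde n \<omega> = cycle_h (\<lambda>k. ptilde k \<omega>) n"
proof -
  have "z_part xs = z_mset (mset xs)" for xs
    by (simp add: z_part_def z_mset_def count_mset)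
  moreover have "prod_list (map f xs) = prod_mset (image_mset f (mset xs))"
    for f :: "nat \<Rightarrow> real" and xs
    by (simp flip: mset_map add: prod_mset_prod_list)
  ultimately have "htilde n \<omega> = (\<Sum>xs\<in>partitions_of n.
      prod_mset (image_mset (\<lambda>k. ptilde k \<omega>) (mset xs)) / real (z_mset (mset xs)))"
    by (simp add: htilde_def)
  also have "\<dots> = cycle_h (\<lambda>k. ptilde k \<omega>) n"
    unfolding cycle_h_def by (rule sum.reindex_bij_betw[OF bij_betw_mset_partitions_of])
  finally show ?thesis .
qed

lemma cycle_h_0: "cycle_h p 0 = 1"
proof -
  have "M = {#}" if "0 \<notin># M" "\<forall>x\<in>#M. x = 0" for M :: "nat multiset"
    using that by (cases M) auto
  hence "partition_msets 0 = {{#}}" by (auto simp: partition_msets_def)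
  thus ?thesis by (simp add: cycle_h_def z_mset_def)
qed

text \<open>Marking one part of a partition of \<open>n\<close>, weighted by its size, counts each partition \<open>n\<close> times;
  removing the marked part gives the right-hand side.\<close>

lemma cycle_h_newton: "real n * cycle_h p n = (\<Sum>k=1..n. p k * cycle_h p (n - k))"
proof -
  define w where "w M = prod_mset (image_mset p M) / real (z_mset M)" for M
  have "real n * cycle_h p n = (\<Sum>M\<in>partition_msets n. real (sum_mset M) * w M)"
    unfolding cycle_h_def sum_distrib_left w_def
    by (intro sum.cong) (simp_all add: partition_msets_def)
  also have "\<dots> = (\<Sum>M\<in>partition_msets n. \<Sum>k\<in>set_mset M. real (count M k * k) * w M)"
    by (subst sum_mset_eq_sum_count) (simp add: sum_distrib_right)
  also have "\<dots> = (\<Sum>(M, k)\<in>Sigma (partition_msets n) set_mset. real (count M k * k) * w M)"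
    by (rule sum.Sigma) (simp_all add: finite_partition_msets)
  also have "\<dots> = (\<Sum>(k, M)\<in>Sigma {1..n} (\<lambda>k. partition_msets (n - k)). p k * w M)"
  proof (rule sum.reindex_bij_witness[where i = "\<lambda>(k, M). (add_mset k M, k)" and
        j = "\<lambda>(M, k). (k, M - {#k#})"], goal_cases)
    case (2 a)
    obtain M k where a: "a = (M, k)" by (cases a)
    obtain M' where "M = add_mset k M'" using 2 unfolding a by (auto dest: multi_member_split)
    thus ?case using 2 unfolding a by (auto simp: partition_msets_def Suc_le_eq intro!: Nat.gr0I)
  next
    case (4 b)
    thus ?case by (auto simp: partition_msets_def)
  next
    case (5 a)
    obtain M k where a: "a = (M, k)" by (cases a)
    obtain M' where M: "M = add_mset k M'" using 5 unfolding a by (auto dest: multi_member_split)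
    have nz: "0 \<notin># M" using 5 unfolding a by (simp add: partition_msets_def)
    hence "z_mset M' \<noteq> 0" "k \<noteq> 0" unfolding M using z_mset_pos[of M'] by auto
    \<comment> \<open>The weight of the marked part, multiplicity times size, equals the factor by
      which that part enlarges \<open>z_mset\<close>, so the two cancel.\<close>
    define d where "d = real (k * Suc (count M' k))"
    have "d \<noteq> 0" using \<open>k \<noteq> 0\<close> by (simp add: d_def del: mult_Suc_right)
    moreover have 1: "real (count M k * k) = d" by (simp add: M d_def)
    moreover have 2: "w M = p k * prod_mset (image_mset p M') / (d * real (z_mset M'))"
      by (simp only: w_def M z_mset_add_mset of_nat_mult d_def image_mset_add_mset prod_mset.add_mset)
    moreover have "M - {#k#} = M'" by (simp add: M)
    ultimately have "real (count M k * k) * w M = p k * w (M - {#k#})"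
      by (simp only: 1 2) (simp add: w_def)
    thus ?case by (simp only: a prod.case)
  qed auto
  also have "\<dots> = (\<Sum>k=1..n. \<Sum>M\<in>partition_msets (n - k). p k * w M)"
    by (rule sum.Sigma[symmetric]) (simp_all add: finite_partition_msets)
  also have "\<dots> = (\<Sum>k=1..n. p k * cycle_h p (n - k))"
    by (simp add: cycle_h_def w_def sum_distrib_left)
  finally show ?thesis .
qed

section \<open>Hook expansion of power sums via the Pieri rule and Jacobi-Trudi determinants\<close>

text \<open>Here \<open>D a b\<close> plays the role of the hook Schur function \<open>s\<^bsub>(a, 1^b)\<^esub>\<close>, \<open>e b = D 1 (b - 1)\<close> that of the
  elementary symmetric function; the last hypothesis is the Pieri rule.\<close>

lemma hook_telescope:
  fixes h e c :: "nat \<Rightarrow> real" and D :: "nat \<Rightarrow> nat \<Rightarrow> real"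
  assumes h0: "h 0 = 1" and e0: "e 0 = 1" and e_Suc: "\<And>b. e (Suc b) = D 1 b"
    and D0: "\<And>a. D a 0 = h a"
    and D_Suc: "\<And>a b. D a (Suc b) = h a * e (Suc b) - D (Suc a) b"
  shows "(\<Sum>k\<le>n. c k * ((-1) ^ k * h (n - k) * e k)) =
    (\<Sum>k<n. (c k - c (Suc k)) * ((-1) ^ k * D (n - k) k)) + (if n = 0 then c 0 else 0)"
proof (cases n)
  case 0
  thus ?thesis by (simp add: h0 e0)
next
  case (Suc m)
  define d where "d k = (-1) ^ k * D (n - k) k" for k
  \<comment> \<open>The Pieri rule makes each product a difference of neighbouring signed hooks; the
    rest is summation by parts against the weights \<open>c\<close>. At the last index
    \<open>h 0 = 1\<close> leaves only \<open>- d m\<close>.\<close>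
  have mid: "(-1) ^ Suc k * h (n - Suc k) * e (Suc k) = d (Suc k) - d k" if "k < m" for k
  proof -
    have "n - k = Suc (n - Suc k)" using that Suc by simp
    thus ?thesis by (simp add: D_Suc d_def algebra_simps)
  qed
  have "(\<Sum>k\<le>n. c k * ((-1) ^ k * h (n - k) * e k)) =
     c 0 * d 0 + (\<Sum>k\<le>m. c (Suc k) * ((-1) ^ Suc k * h (n - Suc k) * e (Suc k)))"
    unfolding Suc sum.atMost_Suc_shift by (simp add: e0 D0 d_def Suc)
  also have "(\<Sum>k\<le>m. c (Suc k) * ((-1) ^ Suc k * h (n - Suc k) * e (Suc k))) =
     (\<Sum>k<m. c (Suc k) * ((-1) ^ Suc k * h (n - Suc k) * e (Suc k))) - c n * d m"
    by (simp add: Suc h0 e_Suc d_def flip: lessThan_Suc_atMost)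
  also have "(\<Sum>k<m. c (Suc k) * ((-1) ^ Suc k * h (n - Suc k) * e (Suc k))) =
     (\<Sum>k<m. c (Suc k) * (d (Suc k) - d k))"
    using mid by (intro sum.cong) auto
  also have "c 0 * d 0 + (\<dots> - c n * d m) =
     (c 0 * d 0 + (\<Sum>k<m. c (Suc k) * d (Suc k))) - ((\<Sum>k<m. c (Suc k) * d k) + c n * d m)"
    by (simp add: sum_subtractf algebra_simps)
  also have "c 0 * d 0 + (\<Sum>k<m. c (Suc k) * d (Suc k)) = (\<Sum>k<n. c k * d k)"
    unfolding Suc by (subst sum.lessThan_Suc_shift) simp
  also have "(\<Sum>k<m. c (Suc k) * d k) + c n * d m = (\<Sum>k<n. c (Suc k) * d k)"
    unfolding Suc by simp
  finally show ?thesis by (simp add: Suc sum_subtractf algebra_simps d_def)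
qed

text \<open>Newton's identities say H' = QH for the generating series, and E is the inverse of H, so
  Q = EH'. The coefficient of EH' is the telescoping sum with weights \<open>n - k\<close>;
  consecutive weights differ by 1, which leaves each hook once with its sign.\<close>

lemma power_sum_eq_hooks:
  fixes p h e :: "nat \<Rightarrow> real" and D :: "nat \<Rightarrow> nat \<Rightarrow> real"
  assumes h0: "h 0 = 1" and e0: "e 0 = 1" and e_Suc: "\<And>b. e (Suc b) = D 1 b"
    and D0: "\<And>a. D a 0 = h a"
    and D_Suc: "\<And>a b. D a (Suc b) = h a * e (Suc b) - D (Suc a) b"
    and newton: "\<And>n. real n * h n = (\<Sum>k=1..n. p k * h (n - k))"
    and n: "n \<ge> 1"
  shows "p n = (\<Sum>k<n. (-1) ^ k * D (n - k) k)"
proof -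
  note tele = hook_telescope[of h e D, OF h0 e0 e_Suc D0 D_Suc]
  define H where "H = Abs_fps h"
  define E where "E = Abs_fps (\<lambda>k. (-1) ^ k * e k)"
  define Q where "Q = Abs_fps (\<lambda>k. p (Suc k))"
  have HE: "E * H = 1"
  proof (rule fps_ext)
    fix n
    show "fps_nth (E * H) n = fps_nth 1 n"
      \<comment> \<open>Constant weights have zero differences, so only the constant coefficient of
        the product survives.\<close>
      using tele[of "\<lambda>_. 1" n]
      unfolding fps_mult_nth atLeast0AtMost by (simp add: E_def H_def mult_ac split: if_splits)
  qed
  have dH: "fps_deriv H = Q * H"
  proof (rule fps_ext)
    fix n
    have "(\<Sum>k=1..Suc n. p k * h (Suc n - k)) = (\<Sum>k=0..n. p (Suc k) * h (n - k))"
      using sum.shift_bounds_cl_Suc_ivl[of "\<lambda>k. p k * h (Suc n - k)" 0 n] by simp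
    thus "fps_nth (fps_deriv H) n = fps_nth (Q * H) n"
      using newton[of "Suc n"] by (simp add: fps_mult_nth H_def Q_def)
  qed
  obtain m where m: "n = Suc m" using n by (cases n) auto
  have "Q = E * fps_deriv H" using HE unfolding dH by (simp add: algebra_simps)
  hence "p n = fps_nth (E * fps_deriv H) m" by (simp add: Q_def m fps_eq_iff)
  also have "\<dots> = (\<Sum>k\<le>m. real (n - k) * ((-1) ^ k * h (n - k) * e k))"
    unfolding fps_mult_nth atLeast0AtMost
    by (intro sum.cong) (auto simp: E_def H_def m Suc_diff_le algebra_simps)
  also have "\<dots> = (\<Sum>k\<le>n. real (n - k) * ((-1) ^ k * h (n - k) * e k))"
    by (simp add: m)
  also have "\<dots> = (\<Sum>k<n. (real (n - k) - real (n - Suc k)) * ((-1) ^ k * D (n - k) k))"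
    using n by (subst tele) simp
  also have "\<dots> = (\<Sum>k<n. (-1) ^ k * D (n - k) k)"
    by (intro sum.cong) (auto simp: of_nat_diff)
  finally show ?thesis .
qed

text \<open>The Jacobi-Trudi determinant of the hook (a, 1^b). Integer indices let the entries below
  the subdiagonal be values of \<open>h\<close> at negative arguments.\<close>

definition hook_det :: "(int \<Rightarrow> 'a::comm_ring_1) \<Rightarrow> int \<Rightarrow> nat \<Rightarrow> 'a" where
  "hook_det h a b = Determinant.det (mat (Suc b) (Suc b)
     (\<lambda>(i, j). if i = 0 then h (a + int j) else h (1 - int i + int j)))"

lemma stilde_hook: "stilde (a # replicate b 1) \<omega> = hook_det (\<lambda>k. htilde_int k \<omega>) (int a) b"
proof -
  have "(a # replicate b 1) ! i = (if i = 0 then a else 1)" if "i < Suc b" for i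
    using that by (cases i) auto
  thus ?thesis
    unfolding stilde_def hook_det_def Determinant.det_def
    by (auto intro!: sum.cong prod.cong simp: lessThan_atLeast0 permutes_in_image)
qed

lemma hook_det_0: "hook_det h a 0 = h a"
  by (simp add: hook_det_def det_single)

text \<open>Laplace expansion along the first column, whose only nonzero entries are \<open>h a\<close> and \<open>h 0\<close>.\<close>

lemma hook_det_Suc:
  assumes h0: "h 0 = 1" and neg: "\<And>k. k < 0 \<Longrightarrow> h k = 0"
  shows "hook_det h a (Suc b) = h a * hook_det h 1 b - hook_det h (a + 1) b"
proof -
  have shift: "1 + int j - int i = 1 - int i + int j" for i j
    by simp
  define A where "A = mat (Suc (Suc b)) (Suc (Suc b))
     (\<lambda>(i, j). if i = 0 then h (a + int j) else h (1 - int i + int j))"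
  have "hook_det h a (Suc b) = (\<Sum>i<Suc (Suc b). A $$ (i, 0) * cofactor A i 0)"
    unfolding hook_det_def A_def[symmetric]
    by (rule laplace_expansion_column) (auto simp: A_def)
  also have "\<dots> = A $$ (0, 0) * cofactor A 0 0 + A $$ (1, 0) * cofactor A 1 0 +
      (\<Sum>i<b. A $$ (Suc (Suc i), 0) * cofactor A (Suc (Suc i)) 0)"
    by (simp add: sum.lessThan_Suc_shift del: sum.lessThan_Suc)
  also have "(\<Sum>i<b. A $$ (Suc (Suc i), 0) * cofactor A (Suc (Suc i)) 0) = 0"
    by (intro sum.neutral ballI) (simp add: A_def neg)
  also have "mat_delete A 0 0 = mat (Suc b) (Suc b)
     (\<lambda>(i, j). if i = 0 then h (1 + int j) else h (1 - int i + int j))"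
    by (rule eq_matI) (auto simp: mat_delete_def A_def shift)
  hence "cofactor A 0 0 = hook_det h 1 b"
    by (simp add: cofactor_def hook_det_def)
  \<comment> \<open>This minor keeps the first row but loses its first entry, which shifts the arm
    length to \<open>a + 1\<close>.\<close>
  also have "mat_delete A 1 0 = mat (Suc b) (Suc b)
     (\<lambda>(i, j). if i = 0 then h (a + 1 + int j) else h (1 - int i + int j))"
    by (rule eq_matI) (auto simp: mat_delete_def A_def add_ac intro!: arg_cong[of _ _ h])
  hence "cofactor A 1 0 = - hook_det h (a + 1) b"
    by (simp add: cofactor_def hook_det_def)
  also have "A $$ (0, 0) = h a" by (simp add: A_def)
  also have "A $$ (1, 0) = 1" by (simp add: A_def h0)
  finally show ?thesis by simp
qed

text \<open>The Murnaghan-Nakayama rule for a single cycle. The derivation uses only Newton's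
  identities and the Jacobi-Trudi form, so it holds for the extended power sums as well.\<close>

lemma ptilde_eq_hook_stilde:
  assumes "n \<ge> 1"
  shows "ptilde n \<omega> = (\<Sum>k<n. (-1) ^ k * stilde ((n - k) # replicate k 1) \<omega>)"
proof -
  define H where "H k = htilde_int k \<omega>" for k
  have H0: "H 0 = 1" by (simp add: H_def htilde_int_def htilde_eq_cycle_h cycle_h_0)
  have neg: "H k = 0" if "k < 0" for k using that by (simp add: H_def htilde_int_def)
  define D where "D a b = hook_det H (int a) b" for a b
  define e where "e b = (case b of 0 \<Rightarrow> 1 | Suc b \<Rightarrow> D 1 b)" for b
  have "ptilde n \<omega> = (\<Sum>k<n. (-1) ^ k * D (n - k) k)"
  proof (rule power_sum_eq_hooks[where h = "\<lambda>n. htilde n \<omega>" and e = e])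
    show "D a 0 = htilde a \<omega>" for a
      by (simp add: D_def hook_det_0) (simp add: H_def htilde_int_def)
    show "D a (Suc b) = htilde a \<omega> * e (Suc b) - D (Suc a) b" for a b
    proof -
      have "H (int a) = htilde a \<omega>" by (simp add: H_def htilde_int_def)
      thus ?thesis using hook_det_Suc[of H "int a" b, OF H0 neg] by (simp add: D_def e_def add.commute)
    qed
  qed (use assms cycle_h_newton in \<open>auto simp: htilde_eq_cycle_h cycle_h_0 e_def\<close>)
  thus ?thesis unfolding stilde_hook D_def H_def .
qed

section \<open>Hook-shaped tableaux\<close>

lemma strict_mono_on_image_unique:
  fixes f g :: "nat \<Rightarrow> nat"
  assumes "strict_mono_on {..<n} f" "strict_mono_on {..<n} g" "f ` {..<n} = g ` {..<n}" "i < n"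
  shows "f i = g i"
proof -
  have sorted: "sorted_wrt (<) (map h [0..<n])" if "strict_mono_on {..<n} h" for h :: "nat \<Rightarrow> nat"
    using that by (auto simp: sorted_wrt_iff_nth_less strict_mono_on_def)
  have "map f [0..<n] = map g [0..<n]"
    using assms(3) by (intro strict_sorted_equal sorted assms(1,2)) (simp add: lessThan_atLeast0)
  thus ?thesis using assms(4) by simp
qed

lemma ex_strict_mono_on_image:
  fixes S :: "nat set"
  assumes "finite S"
  obtains f where "strict_mono_on {..<card S} f" "f ` {..<card S} = S"
proof
  let ?xs = "sorted_list_of_set S"
  show "strict_mono_on {..<card S} (\<lambda>i. ?xs ! i)"
    using strict_sorted_list_of_set[of S]
    by (auto simp: strict_mono_on_def sorted_wrt_iff_nth_less)
  show "(\<lambda>i. ?xs ! i) ` {..<card S} = S"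
    using set_conv_nth[of ?xs] assms by auto
qed

lemma cells_hook:
  assumes "a \<ge> 1"
  shows "cells (a # replicate b 1) = (\<lambda>j. (0, j)) ` {..<a} \<union> (\<lambda>i. (Suc i, 0)) ` {..<b}"
proof -
  have "(i, j) \<in> cells (a # replicate b 1) \<longleftrightarrow>
      (i, j) \<in> (\<lambda>j. (0, j)) ` {..<a} \<union> (\<lambda>i. (Suc i, 0)) ` {..<b}" for i j
    by (cases i) (auto simp: cells_def)
  thus ?thesis by auto
qed

text \<open>A standard tableau of hook shape is determined by the set of its entries in the first column
  below the corner, and the corner entry is always 1.\<close>

lemma dim_part_hook: "dim_part (Suc a # replicate b 1) = (a + b) choose b"
proof -
  define n where "n = Suc (a + b)"
  define C where "C = cells (Suc a # replicate b 1)"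
  define F where "F = {f. f \<in> C \<rightarrow>\<^sub>E {1..n} \<and> bij_betw f C {1..n} \<and>
      (\<forall>i j. (i, j + 1) \<in> C \<longrightarrow> f (i, j) < f (i, j + 1)) \<and>
      (\<forall>i j. (i + 1, j) \<in> C \<longrightarrow> f (i, j) < f (i + 1, j))}"
  define \<Phi> where "\<Phi> f = (\<lambda>i. f (Suc i, 0 :: nat)) ` {..<b}" for f :: "nat \<times> nat \<Rightarrow> nat"
  have C: "C = (\<lambda>j. (0, j)) ` {..<Suc a} \<union> (\<lambda>i. (Suc i, 0)) ` {..<b}"
    unfolding C_def by (rule cells_hook) simp
  have C_row: "(0, j) \<in> C \<longleftrightarrow> j < Suc a" for j by (auto simp: C)
  have C_col: "(Suc i, j) \<in> C \<longleftrightarrow> j = 0 \<and> i < b" for i j by (auto simp: C)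
  have sum_list: "sum_list (Suc a # replicate b 1) = n"
    by (simp add: n_def sum_list_replicate)
  have dim: "dim_part (Suc a # replicate b 1) = card F"
    unfolding dim_part_def sum_list F_def C_def by simp
  have row: "strict_mono_on {..<Suc a} (\<lambda>j. f (0, j))" if "f \<in> F" for f
  proof -
    have "j < Suc a \<Longrightarrow> i < j \<Longrightarrow> f (0, i) < f (0, j)" for i j
    proof (induction j)
      case (Suc j)
      have "f (0, j) < f (0, Suc j)" using Suc.prems that by (auto simp: F_def C_row)
      thus ?case using Suc by (cases "i = j") auto
    qed simp
    thus ?thesis by (auto simp: strict_mono_on_def)
  qed
  have col: "strict_mono_on {..<Suc b} (\<lambda>i. f (i, 0))" if "f \<in> F" for f
  proof -
    have "j < Suc b \<Longrightarrow> i < j \<Longrightarrow> f (i, 0) < f (j, 0)" for i j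
    proof (induction j)
      case (Suc j)
      have "f (j, 0) < f (Suc j, 0)" using Suc.prems that by (auto simp: F_def C_col)
      thus ?case using Suc by (cases "i = j") auto
    qed simp
    thus ?thesis by (auto simp: strict_mono_on_def)
  qed
  have col': "strict_mono_on {..<b} (\<lambda>i. f (Suc i, 0))" if "f \<in> F" for f
    using col[OF that] by (auto simp: strict_mono_on_def)
  have image: "f ` C = {1..n}" "inj_on f C" if "f \<in> F" for f
    using that by (auto simp: F_def bij_betw_def)
  have corner: "f (0, 0) = 1" if f: "f \<in> F" for f
  proof -
    have le: "f (0, 0) \<le> f x" if "x \<in> C" for x
    proof -
      from that consider j where "x = (0, j)" "j < Suc a" | i where "x = (i, 0)" "i < Suc b"
        unfolding C by auto
      thus ?thesis
      proof cases
        case 1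
        thus ?thesis using strict_mono_onD[OF row[OF f], of 0 j] by (cases "j = 0") auto
      next
        case 2
        thus ?thesis using strict_mono_onD[OF col[OF f], of 0 i] by (cases "i = 0") auto
      qed
    qed
    have "1 \<in> f ` C" unfolding image[OF f] by (simp add: n_def)
    hence "f (0, 0) \<le> 1" using le by auto
    moreover have "f (0, 0) \<in> {1..n}" unfolding image(1)[OF f, symmetric] using C_row[of 0] by auto
    ultimately show ?thesis by simp
  qed
  \<comment> \<open>The first row holds the complement of the column set. Both are filled
    increasingly, so the column set fixes the whole tableau.\<close>
  have \<Phi>_image: "f ` (\<lambda>j. (0, j)) ` {..<Suc a} = {1..n} - \<Phi> f" if f: "f \<in> F" for f
  proof -
    have "f ` ((\<lambda>j. (0, j)) ` {..<Suc a}) = f ` C - f ` ((\<lambda>i. (Suc i, 0)) ` {..<b})"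
      by (subst inj_on_image_set_diff[OF image(2)[OF f], symmetric]) (auto simp: C)
    thus ?thesis by (simp add: image(1)[OF f] \<Phi>_def image_image)
  qed
  \<comment> \<open>The entry 1 sits in the corner, so exactly the \<open>a + b\<close> values from
    2 to \<open>n\<close> are available below it.\<close>
  have "bij_betw \<Phi> F {S. S \<subseteq> {2..n} \<and> card S = b}"
    unfolding bij_betw_def
  proof
    show "inj_on \<Phi> F"
    proof (rule inj_onI)
      fix f g assume f: "f \<in> F" and g: "g \<in> F" and eq: "\<Phi> f = \<Phi> g"
      have "f x = g x" if x: "x \<in> C" for x
      proof -
        from x consider j where "x = (0, j)" "j < Suc a" | i where "x = (Suc i, 0)" "i < b"
          unfolding C by auto
        thus ?thesis
        proof cases
          case 1
          have "(\<lambda>j. f (0, j)) ` {..<Suc a} = (\<lambda>j. g (0, j)) ` {..<Suc a}"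
            using \<Phi>_image[OF f] \<Phi>_image[OF g] eq by (simp add: image_image)
          thus ?thesis using strict_mono_on_image_unique[OF row[OF f] row[OF g]] 1 by simp
        next
          case 2
          thus ?thesis
            using strict_mono_on_image_unique[OF col'[OF f] col'[OF g]] eq by (simp add: \<Phi>_def)
        qed
      qed
      moreover have "f \<in> C \<rightarrow>\<^sub>E {1..n}" "g \<in> C \<rightarrow>\<^sub>E {1..n}" using f g by (simp_all add: F_def)
      ultimately show "f = g" by (intro PiE_ext)
    qed
    show "\<Phi> ` F = {S. S \<subseteq> {2..n} \<and> card S = b}"
    proof (intro equalityI subsetI)
      fix S assume "S \<in> \<Phi> ` F"
      then obtain f where f: "f \<in> F" and S: "S = \<Phi> f" by blast
      have "S \<subseteq> {2..n}"
      proof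
        fix y assume "y \<in> S"
        then obtain i where i: "i < b" "y = f (Suc i, 0)" by (auto simp: S \<Phi>_def)
        have "y \<in> {1..n}" unfolding image(1)[OF f, symmetric] i(2) using C_col[of i 0] i(1) by auto
        moreover have "1 < y"
          using strict_mono_onD[OF col[OF f], of 0 "Suc i"] i corner[OF f] by simp
        ultimately show "y \<in> {2..n}" by simp
      qed
      moreover have "inj_on (\<lambda>i. f (Suc i, 0)) {..<b}"
        using col'[OF f] by (rule strict_mono_on_imp_inj_on)
      hence "card S = b" by (simp add: S \<Phi>_def card_image)
      ultimately show "S \<in> {S. S \<subseteq> {2..n} \<and> card S = b}" by simp
    next
      fix S assume "S \<in> {S. S \<subseteq> {2..n} \<and> card S = b}"
      hence S: "S \<subseteq> {2..n}" "card S = b" by auto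
      \<comment> \<open>Conversely, list \<open>S\<close> increasingly down the column and its
        complement \<open>R\<close> along the row. Since 1 lies in \<open>R\<close>, it lands in the
        corner, below every entry of \<open>S\<close> in value.\<close>
      define R where "R = {1..n} - S"
      have fin: "finite S" "finite R" using S(1) finite_subset by (auto simp: R_def)
      have cR: "card R = Suc a"
        using S fin(1) by (subst R_def, subst card_Diff_subset) (auto simp: n_def)
      obtain r where "strict_mono_on {..<card R} r" "r ` {..<card R} = R"
        by (rule ex_strict_mono_on_image[OF fin(2)])
      note r = this[unfolded cR]
      obtain s where "strict_mono_on {..<card S} s" "s ` {..<card S} = S"
        by (rule ex_strict_mono_on_image[OF fin(1)])
      note s = this[unfolded S(2)]
      have "1 \<in> R" using S(1) by (auto simp: R_def n_def)
      then obtain j where j: "j < Suc a" "r j = 1" using r(2) by auto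
      have "r 0 \<in> R" using r(2) by auto
      hence "r 0 \<ge> 1" by (auto simp: R_def)
      hence r0: "r 0 = 1" using strict_mono_onD[OF r(1), of 0 j] j by (cases "j = 0") auto
      define f where "f = restrict (\<lambda>(i, j). case i of 0 \<Rightarrow> r j | Suc i \<Rightarrow> s i) C"
      have f_row: "f (0, j) = r j" if "j < Suc a" for j using that by (simp add: f_def C_row)
      have f_col: "f (Suc i, 0) = s i" if "i < b" for i using that by (simp add: f_def C_col)
      have "f ` C = r ` {..<Suc a} \<union> s ` {..<b}"
        unfolding C image_Un image_image using f_row f_col by (intro arg_cong2[where f = union] image_cong) auto
      also have "\<dots> = {1..n}" using r s S(1) by (auto simp: R_def)
      finally have fC: "f ` C = {1..n}" .
      have "finite C" by (simp add: C)
      moreover have "card C = n"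
      proof -
        have "card C = card ((\<lambda>j. (0::nat, j)) ` {..<Suc a}) + card ((\<lambda>i. (Suc i, 0::nat)) ` {..<b})"
          unfolding C by (rule card_Un_disjoint) auto
        thus ?thesis by (simp add: card_image inj_on_def n_def)
      qed
      ultimately have "inj_on f C" by (intro eq_card_imp_inj_on) (simp_all add: fC)
      hence bij: "bij_betw f C {1..n}" by (simp add: bij_betw_def fC)
      have s_gt: "1 < s i" if "i < b" for i
      proof -
        have "s i \<in> S" using s(2) that by auto
        thus ?thesis using S(1) by auto
      qed
      have "f \<in> F"
        unfolding F_def
      proof (intro CollectI conjI allI impI)
        show "f \<in> C \<rightarrow>\<^sub>E {1..n}" using fC by (auto simp: f_def restrict_def)
        show "bij_betw f C {1..n}" by (rule bij)
        show "f (i, j) < f (i, j + 1)" if "(i, j + 1) \<in> C" for i j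
          using that strict_mono_onD[OF r(1), of j "Suc j"] by (cases i) (auto simp: C_row C_col f_row)
        show "f (i, j) < f (i + 1, j)" if "(i + 1, j) \<in> C" for i j
          using that strict_mono_onD[OF s(1), of "i - 1" i] s_gt[of 0]
          by (cases i) (auto simp: C_row C_col f_row f_col r0)
      qed
      moreover have "\<Phi> f = S" using f_col s(2) by (simp add: \<Phi>_def)
      ultimately show "S \<in> \<Phi> ` F" by blast
    qed
  qed
  hence "card F = card {S. S \<subseteq> {2..n} \<and> card S = b}" by (rule bij_betw_same_card)
  also have "\<dots> = (a + b) choose b" by (subst n_subsets) (simp_all add: n_def)
  finally show ?thesis by (simp only: dim)
qed

text \<open>The contents of a hook are the consecutive integers from \<open>- b\<close> to
  \<open>a\<close>, each occurring once: the leg gives the negative ones and the row the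
  others.\<close>

lemma prod_cells_hook:
  fixes z :: "'a::comm_ring_1"
  shows "(\<Prod>(i, j)\<in>cells (Suc a # replicate b 1). z + of_int (int j - int i)) =
    pochhammer (z - of_nat b) (Suc a + b)"
proof -
  let ?f = "\<lambda>(i, j). z + of_int (int j - int i)"
  have "prod ?f (cells (Suc a # replicate b 1)) =
      prod ?f ((\<lambda>j. (0, j)) ` {..<Suc a}) * prod ?f ((\<lambda>i. (Suc i, 0)) ` {..<b})"
    by (subst cells_hook) (auto intro!: prod.union_disjoint)
  also have "prod ?f ((\<lambda>j. (0, j)) ` {..<Suc a}) = (\<Prod>j<Suc a. z + of_nat j)"
    by (subst prod.reindex) (auto simp: inj_on_def)
  also have "\<dots> = pochhammer z (Suc a)"
    by (simp add: pochhammer_prod lessThan_atLeast0)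
  also have "prod ?f ((\<lambda>i. (Suc i, 0)) ` {..<b}) = (\<Prod>i<b. z - of_nat (Suc i))"
    by (subst prod.reindex) (auto simp: inj_on_def intro!: prod.cong)
  also have "\<dots> = (\<Prod>i<b. z - of_nat b + of_nat (b - Suc i))"
    by (intro prod.cong) (auto simp: of_nat_diff)
  also have "\<dots> = pochhammer (z - of_nat b) b"
    by (subst prod.nat_diff_reindex) (simp add: pochhammer_prod lessThan_atLeast0)
  finally show ?thesis
    using pochhammer_product'[of "z - of_nat b" b "Suc a"] by (simp add: mult.commute add.commute)
qed

text \<open>One of the two dimension factors in \<open>Mzz\<close> cancels, and the other is the
  binomial coefficient. Up to its sign, the result is a normalised term of
  \<open>hook_sum\<close>.\<close>

lemma Mzz_hook:
  assumes "k < n"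
  defines "lam \<equiv> (n - k) # replicate k 1"
  shows "Mzz z z' lam / of_nat (dim_part lam) = of_nat ((n - 1) choose k) *
      pochhammer (z - of_nat k) n * pochhammer (z' - of_nat k) n / (pochhammer (z * z') n * fact n)"
proof -
  define a where "a = n - Suc k"
  have a: "n - k = Suc a" "n = Suc a + k" using assms(1) by (simp_all add: a_def)
  have dim: "dim_part lam = (n - 1) choose k" unfolding lam_def a(1) dim_part_hook by (simp add: a(2))
  hence dim_nz: "dim_part lam \<noteq> 0" using assms(1) by simp
  have sum: "sum_list lam = n" by (simp add: lam_def sum_list_replicate a)
  have "(\<Prod>(i, j)\<in>cells lam. (z + of_int (int j - int i)) * (z' + of_int (int j - int i))) =
      (\<Prod>(i, j)\<in>cells lam. z + of_int (int j - int i)) * (\<Prod>(i, j)\<in>cells lam. z' + of_int (int j - int i))"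
    by (simp add: prod.distrib case_prod_beta)
  also have "\<dots> = pochhammer (z - of_nat k) n * pochhammer (z' - of_nat k) n"
    unfolding lam_def a(1) prod_cells_hook by (simp only: a(2))
  finally have "Mzz z z' lam / of_nat (dim_part lam) =
      pochhammer (z - of_nat k) n * pochhammer (z' - of_nat k) n / pochhammer (z * z') n *
      (of_nat (dim_part lam))\<^sup>2 / of_nat (fact n) / of_nat (dim_part lam)"
    unfolding Mzz_def sum by (simp only:)
  also have "\<dots> = of_nat (dim_part lam) *
      pochhammer (z - of_nat k) n * pochhammer (z' - of_nat k) n / (pochhammer (z * z') n * fact n)"
    using dim_nz by (simp add: power2_eq_square)
  finally show ?thesis unfolding dim .
qed

section \<open>Polynomials concentrating at the origin\<close>

text \<open>The polynomial (1 - y)^N with its coefficient of y^j multiplied by \<open>q j\<close>;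
  later y is the square of x.\<close>

definition altsum :: "nat \<Rightarrow> (nat \<Rightarrow> real) \<Rightarrow> real \<Rightarrow> real" where
  "altsum N q y = (\<Sum>j\<le>N. real (N choose j) * (-1) ^ j * q j * y ^ j)"

text \<open>The multiplier \<open>j choose r\<close> acts as y^r / r! times the r-th derivative,
  which turns (1 - y)^N into a signed Bernstein polynomial. The proof regroups the product of
  binomials and sums by the binomial theorem.\<close>

lemma altsum_binomial: "altsum N (\<lambda>j. real (j choose r)) y = (-1) ^ r * Bernstein N r y"
proof (cases "r \<le> N")
  case True
  define n where "n = N - r"
  have N: "N = r + n" using True by (simp add: n_def)
  have "altsum N (\<lambda>j. real (j choose r)) y =
      (\<Sum>j=r..r + n. real (N choose j) * (-1) ^ j * real (j choose r) * y ^ j)"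
    unfolding altsum_def by (rule sum.mono_neutral_right) (auto simp: N binomial_eq_0)
  also have "\<dots> = (\<Sum>i\<le>n. real (N choose (i + r)) * (-1) ^ (i + r) * real ((i + r) choose r) * y ^ (i + r))"
    using sum.shift_bounds_cl_nat_ivl[of "\<lambda>j. real (N choose j) * (-1) ^ j * real (j choose r) * y ^ j" 0 r n]
    by (simp add: atLeast0AtMost add.commute)
  also have "\<dots> = (\<Sum>i\<le>n. ((-1) ^ r * real (N choose r) * y ^ r) * (real (n choose i) * (-y) ^ i * 1 ^ (n - i)))"
  proof (intro sum.cong refl)
    fix i assume "i \<in> {..n}"
    hence "(N choose (i + r)) * ((i + r) choose r) = (N choose r) * (n choose i)"
      using choose_mult[of r "i + r" N] by (simp add: N)
    hence "real (N choose (i + r)) * real ((i + r) choose r) = real (N choose r) * real (n choose i)"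
      by (simp flip: of_nat_mult)
    moreover have "(-y) ^ i = (-1) ^ i * y ^ i" by (simp flip: power_mult_distrib)
    moreover have "real (N choose (i + r)) * (-1) ^ (i + r) * real ((i + r) choose r) * y ^ (i + r) =
      (real (N choose (i + r)) * real ((i + r) choose r)) * ((-1) ^ r * y ^ r * ((-1) ^ i * y ^ i))"
      by (simp only: power_add mult_ac)
    ultimately show "real (N choose (i + r)) * (-1) ^ (i + r) * real ((i + r) choose r) * y ^ (i + r) =
      ((-1) ^ r * real (N choose r) * y ^ r) * (real (n choose i) * (-y) ^ i * 1 ^ (n - i))"
      by (simp only: power_one mult_ac mult_1_right)
  qed
  also have "\<dots> = (-1) ^ r * real (N choose r) * y ^ r * (-y + 1) ^ n"
    by (simp only: sum_distrib_left[symmetric] binomial_ring[of "-y" 1 n])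
  finally show ?thesis by (simp add: Bernstein_def n_def)
next
  case False
  thus ?thesis by (simp add: altsum_def Bernstein_def binomial_eq_0)
qed

lemma Bernstein_le_1:
  assumes "0 \<le> y" "y \<le> 1"
  shows "Bernstein N r y \<le> 1"
proof (cases "r \<le> N")
  case True
  have "Bernstein N r y \<le> (\<Sum>k\<le>N. Bernstein N k y)"
    by (rule member_le_sum) (use assms True in \<open>auto intro: Bernstein_nonneg\<close>)
  thus ?thesis by simp
qed (simp add: Bernstein_def binomial_eq_0)

lemma power_times_geometric_limit_0:
  fixes x :: real
  assumes "0 \<le> x" "x < 1"
  shows "(\<lambda>n. real n ^ r * x ^ n) \<longlonglongrightarrow> 0"
proof -
  \<comment> \<open>With this root, n^r x^n = (n u^n)^r u^n, so the known limit of n u^n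
    suffices.\<close>
  define u where "u = root (Suc r) x"
  have u: "0 \<le> u" "u < 1" "u ^ Suc r = x"
    using assms by (simp_all add: u_def del: power_Suc)
  have "(\<lambda>n. (real n * u ^ n) ^ r * u ^ n) \<longlonglongrightarrow> 0 ^ r * 0"
    using powser_times_n_limit_0[of u] u
    by (intro tendsto_mult tendsto_power LIMSEQ_power_zero) auto
  also have "(\<lambda>n. (real n * u ^ n) ^ r * u ^ n) = (\<lambda>n. real n ^ r * x ^ n)"
  proof
    fix n
    have "x ^ n = (u ^ n) ^ r * u ^ n" unfolding u(3)[symmetric]
      by (simp add: power_mult_distrib mult.commute flip: power_mult)
    thus "(real n * u ^ n) ^ r * u ^ n = real n ^ r * x ^ n" by (simp add: power_mult_distrib)
  qed
  finally show ?thesis by simp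
qed

text \<open>For y < 1 the geometric factor (1 - y)^N beats the growth N^r; at y = 1 the value is 0
  as soon as N > r. At y = 0 the case r = 0 is constantly 1, and this is what isolates the
  atom.\<close>

lemma Bernstein_limit_0:
  assumes y: "0 < y" "y \<le> 1"
  shows "(\<lambda>N. Bernstein N r y) \<longlonglongrightarrow> 0"
proof (cases "y = 1")
  case True
  have "eventually (\<lambda>N. Bernstein N r y = 0) sequentially"
    using eventually_gt_at_top[of r] by eventually_elim (simp add: True Bernstein_def)
  thus ?thesis by (rule tendsto_eventually)
next
  case False
  define x where "x = 1 - y"
  have x: "0 < x" "x < 1" using y False by (auto simp: x_def)
  show ?thesis
  proof (rule Lim_null_comparison)
    show "eventually (\<lambda>N. norm (Bernstein N r y) \<le> (real N ^ r * x ^ N) / x ^ r) sequentially"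
      using eventually_ge_at_top[of r]
    proof eventually_elim
      case (elim N)
      have "Bernstein N r y \<le> real (N choose r) * 1 * x ^ (N - r)"
        unfolding Bernstein_def x_def[symmetric]
        using x y by (intro mult_right_mono mult_left_mono power_le_one) auto
      also have "\<dots> \<le> real N ^ r * x ^ (N - r)"
        using binomial_le_pow[OF elim] x by (auto intro!: mult_right_mono simp flip: of_nat_power)
      also have "x ^ (N - r) = x ^ N / x ^ r"
        using elim x by (simp add: power_diff)
      finally show ?case using Bernstein_nonneg[of y N r] y by simp
    qed
    show "(\<lambda>N. (real N ^ r * x ^ N) / x ^ r) \<longlonglongrightarrow> 0"
      using tendsto_divide[OF power_times_geometric_limit_0[of x r] tendsto_const[of "x ^ r"]] x by simp
  qed
qed

text \<open>A third-order operator such as L multiplies the coefficients of powers of x by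
  polynomials of degree at most 3 in the exponent.\<close>

definition cubic :: "(nat \<Rightarrow> real) \<Rightarrow> bool" where
  "cubic q \<longleftrightarrow> (\<exists>c0 c1 c2 c3. \<forall>j. q j = c0 + c1 * real j + c2 * real j ^ 2 + c3 * real j ^ 3)"

lemma cubicI:
  "(\<And>j. q j = c0 + c1 * real j + c2 * real j ^ 2 + c3 * real j ^ 3) \<Longrightarrow> cubic q"
  unfolding cubic_def by blast

lemma cubic_binomial_expansion:
  assumes "cubic q"
  obtains d where "\<And>j. q j = (\<Sum>r\<le>3. d r * real (j choose r))"
proof -
  from assms obtain c0 c1 c2 c3
    where q: "q j = c0 + c1 * real j + c2 * real j ^ 2 + c3 * real j ^ 3" for j
    unfolding cubic_def by blast
  have b2: "real (j choose 2) = real j * (real j - 1) / 2" for j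
    by (induction j) (auto simp: numeral_2_eq_2 algebra_simps)
  have b3: "real (j choose 3) = real j * (real j - 1) * (real j - 2) / 6" for j
  proof (induction j)
    case (Suc j)
    have "real (Suc j choose 3) = real (j choose 2) + real (j choose 3)"
      by (simp add: numeral_3_eq_3 numeral_2_eq_2)
    thus ?case unfolding Suc b2 by (simp add: field_simps)
  qed simp
  \<comment> \<open>Change from powers of \<open>j\<close> to binomial coefficients: the multipliers
    are Stirling numbers of the second kind times factorials.\<close>
  let ?d = "\<lambda>r::nat. if r = 0 then c0 else if r = 1 then c1 + c2 + c3 else
      if r = 2 then 2 * c2 + 6 * c3 else 6 * c3"
  have "q j = (\<Sum>r\<le>3. ?d r * real (j choose r))" for j
  proof -
    have "{..3::nat} = {0, 1, 2, 3}" by auto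
    hence "(\<Sum>r\<le>3. ?d r * real (j choose r)) = c0 + (c1 + c2 + c3) * real j +
        (2 * c2 + 6 * c3) * real (j choose 2) + 6 * c3 * real (j choose 3)"
      by simp
    thus ?thesis unfolding q b2 b3 by (simp add: field_simps power2_eq_square power3_eq_cube)
  qed
  thus ?thesis by (rule that)
qed

lemma altsum_eq_Bernstein:
  assumes "\<And>j. q j = (\<Sum>r\<le>R. d r * real (j choose r))"
  shows "altsum N q y = (\<Sum>r\<le>R. d r * ((-1) ^ r * Bernstein N r y))"
proof -
  have "altsum N q y = (\<Sum>j\<le>N. \<Sum>r\<le>R. d r * (real (N choose j) * (-1) ^ j * real (j choose r) * y ^ j))"
    unfolding altsum_def assms sum_distrib_left sum_distrib_right
    by (intro sum.cong) (simp_all add: mult_ac)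
  also have "\<dots> = (\<Sum>r\<le>R. d r * altsum N (\<lambda>j. real (j choose r)) y)"
    unfolding altsum_def sum_distrib_left by (rule sum.swap)
  finally show ?thesis by (simp add: altsum_binomial)
qed

lemma altsum_cubic_bounded:
  assumes "cubic q"
  obtains B where "B \<ge> 0" "\<And>N y. 0 \<le> y \<Longrightarrow> y \<le> 1 \<Longrightarrow> \<bar>altsum N q y\<bar> \<le> B"
proof -
  from assms obtain d where d: "\<And>j. q j = (\<Sum>r\<le>3. d r * real (j choose r))"
    using cubic_binomial_expansion by blast
  have "\<bar>altsum N q y\<bar> \<le> (\<Sum>r\<le>3. \<bar>d r\<bar>)" if "0 \<le> y" "y \<le> 1" for N y
    unfolding altsum_eq_Bernstein[OF d]
    using Bernstein_nonneg[OF that] Bernstein_le_1[OF that]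
    by (intro order_trans[OF sum_abs] sum_mono) (simp add: abs_mult mult_left_le)
  moreover have "0 \<le> (\<Sum>r\<le>3. \<bar>d r\<bar>)" by (simp add: sum_nonneg)
  ultimately show ?thesis using that by blast
qed

lemma altsum_cubic_limit_0:
  assumes "cubic q" "0 < y" "y \<le> 1"
  shows "(\<lambda>N. altsum N q y) \<longlonglongrightarrow> 0"
proof -
  from assms(1) obtain d where d: "\<And>j. q j = (\<Sum>r\<le>3. d r * real (j choose r))"
    using cubic_binomial_expansion by blast
  have "(\<lambda>N. \<Sum>r\<le>3. d r * ((-1) ^ r * Bernstein N r y)) \<longlonglongrightarrow> (\<Sum>r\<le>3. d r * ((-1) ^ r * 0))"
    by (intro tendsto_intros Bernstein_limit_0 assms)
  thus ?thesis by (simp add: altsum_eq_Bernstein[OF d])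
qed

section \<open>Power sums on the simplex as moments, and the extraction of \<gamma>\<close>

lemma Thoma_simplexD:
  assumes "\<omega> \<in> Thoma_simplex"
  shows "th_alpha \<omega> i \<ge> 0" "th_beta \<omega> i \<ge> 0" "th_gamma \<omega> \<ge> 0"
    "summable (th_alpha \<omega>)" "summable (th_beta \<omega>)"
    "suminf (th_alpha \<omega>) + suminf (th_beta \<omega>) + th_gamma \<omega> = 1"
    "th_alpha \<omega> i \<le> 1" "th_beta \<omega> i \<le> 1"
proof -
  have nn: "th_alpha \<omega> i \<ge> 0" "th_beta \<omega> i \<ge> 0" "th_gamma \<omega> \<ge> 0" for i
    using assms by (auto simp: Thoma_simplex_def)
  have s: "(\<lambda>i. th_alpha \<omega> i + th_beta \<omega> i) sums (1 - th_gamma \<omega>)"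
    using assms by (auto simp: Thoma_simplex_def)
  have sa: "summable (th_alpha \<omega>)" and sb: "summable (th_beta \<omega>)"
    by (rule summable_comparison_test'[OF sums_summable[OF s], of 0]; simp add: nn)+
  have total: "suminf (th_alpha \<omega>) + suminf (th_beta \<omega>) + th_gamma \<omega> = 1"
    using sums_unique[OF s] suminf_add[OF sa sb] by simp
  have "th_alpha \<omega> i \<le> suminf (th_alpha \<omega>)" "th_beta \<omega> i \<le> suminf (th_beta \<omega>)"
    using sum_le_suminf[OF sa, of "{i}"] sum_le_suminf[OF sb, of "{i}"] nn by auto
  moreover have "suminf (th_alpha \<omega>) \<ge> 0" "suminf (th_beta \<omega>) \<ge> 0"
    using nn by (auto intro!: suminf_nonneg sa sb)
  ultimately show "th_alpha \<omega> i \<le> 1" "th_beta \<omega> i \<le> 1"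
    using total nn(3) by linarith+
  show "th_alpha \<omega> i \<ge> 0" "th_beta \<omega> i \<ge> 0" "th_gamma \<omega> \<ge> 0" by (fact nn)+
  show "summable (th_alpha \<omega>)" by (fact sa)
  show "summable (th_beta \<omega>)" by (fact sb)
  show "suminf (th_alpha \<omega>) + suminf (th_beta \<omega>) + th_gamma \<omega> = 1" by (fact total)
qed

lemma summable_power_le:
  fixes f :: "nat \<Rightarrow> real"
  assumes "summable f" "\<And>i. 0 \<le> f i" "\<And>i. f i \<le> 1" "n \<ge> 1"
  shows "summable (\<lambda>i. f i ^ n)"
proof (rule summable_comparison_test'[OF assms(1), of 0])
  fix i
  have "f i ^ n \<le> f i ^ 1" using assms(2-4) by (intro power_decreasing)
  thus "norm (f i ^ n) \<le> f i" using assms(2) by simp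
qed

text \<open>This is the moment of degree \<open>n - 1\<close> of \<nu>: mass \<alpha> at \<alpha>
  gives \<alpha>^n, mass \<beta> at -\<beta> gives -(-\<beta>)^n, and the mass \<gamma> at 0 is seen
  only in degree 0.\<close>

lemma ptilde_eq:
  assumes \<omega>: "\<omega> \<in> Thoma_simplex" and n: "n \<ge> 1"
  shows "summable (\<lambda>i. th_alpha \<omega> i ^ n - (- th_beta \<omega> i) ^ n)"
    and "ptilde n \<omega> = (\<Sum>i. th_alpha \<omega> i ^ n - (- th_beta \<omega> i) ^ n) + (if n = 1 then th_gamma \<omega> else 0)"
proof -
  note D = Thoma_simplexD[OF \<omega>]
  have sa: "summable (\<lambda>i. th_alpha \<omega> i ^ n)" and sb: "summable (\<lambda>i. th_beta \<omega> i ^ n)"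
    using D n by (auto intro!: summable_power_le)
  have minus: "(- th_beta \<omega> i) ^ n = (-1) ^ n * th_beta \<omega> i ^ n" for i
    by (simp flip: power_mult_distrib)
  have sb': "summable (\<lambda>i. (- th_beta \<omega> i) ^ n)"
    unfolding minus by (intro summable_mult sb)
  show "summable (\<lambda>i. th_alpha \<omega> i ^ n - (- th_beta \<omega> i) ^ n)"
    by (intro summable_diff sa sb')
  have "(\<Sum>i. th_alpha \<omega> i ^ n - (- th_beta \<omega> i) ^ n) =
      (\<Sum>i. th_alpha \<omega> i ^ n) - (-1) ^ n * (\<Sum>i. th_beta \<omega> i ^ n)"
    unfolding suminf_diff[OF sa sb', symmetric] unfolding minus suminf_mult[OF sb] ..
  moreover have "(-1) ^ n = - ((-1) ^ (n - 1) :: real)"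
    using n by (cases n) auto
  ultimately show "ptilde n \<omega> = (\<Sum>i. th_alpha \<omega> i ^ n - (- th_beta \<omega> i) ^ n) + (if n = 1 then th_gamma \<omega> else 0)"
    using D(6) by (auto simp: ptilde_def)
qed

lemma abs_ptilde_le_1:
  assumes \<omega>: "\<omega> \<in> Thoma_simplex" and n: "n \<ge> 1"
  shows "\<bar>ptilde n \<omega>\<bar> \<le> 1"
proof (cases "n = 1")
  case False
  note D = Thoma_simplexD[OF \<omega>]
  have *: "0 \<le> suminf (\<lambda>i. f i ^ n) \<and> suminf (\<lambda>i. f i ^ n) \<le> suminf f"
    if "summable f" "\<And>i. 0 \<le> f i" "\<And>i. f i \<le> 1" for f :: "nat \<Rightarrow> real"
  proof -
    have "f i ^ n \<le> f i ^ 1" for i using that n by (intro power_decreasing)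
    thus ?thesis using that summable_power_le[OF that n] by (auto intro!: suminf_nonneg suminf_le)
  qed
  have "\<bar>ptilde n \<omega>\<bar> \<le> \<bar>\<Sum>i. th_alpha \<omega> i ^ n\<bar> + \<bar>\<Sum>i. th_beta \<omega> i ^ n\<bar>"
    using False by (simp add: ptilde_def abs_mult order_trans[OF abs_triangle_ineq])
  also have "\<dots> \<le> suminf (th_alpha \<omega>) + suminf (th_beta \<omega>)"
    using *[of "th_alpha \<omega>"] *[of "th_beta \<omega>"] D by simp
  finally show ?thesis using D(3,6) by linarith
qed (simp add: ptilde_def)

text \<open>The functional applied to L f for f = x(1 - x^2)^N, where \<open>a j\<close>,
  \<open>b j\<close>, \<open>c j\<close> are the coefficients of L on x^(2j+1). The indices of
  \<open>m\<close> are those of power sums, one more than the degree of the moment.\<close>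

definition moment_comb :: "(nat \<Rightarrow> real) \<Rightarrow> (nat \<Rightarrow> real) \<Rightarrow> (nat \<Rightarrow> real) \<Rightarrow> nat \<Rightarrow> (nat \<Rightarrow> real) \<Rightarrow> real" where
  "moment_comb a b c N m = (\<Sum>j\<le>N. real (N choose j) * (-1) ^ j *
     (a j * m (2 * j + 3) + b j * m (2 * j + 2) + c j * m (2 * j + 1)))"

text \<open>On the powers of x the combination is x times L f, the factor x being the mass that
  \<nu> attaches to the point x, up to sign.\<close>

lemma moment_comb_power:
  "moment_comb a b c N (\<lambda>n. x ^ n) =
    x ^ 3 * altsum N a (x\<^sup>2) + x\<^sup>2 * altsum N b (x\<^sup>2) + x * altsum N c (x\<^sup>2)"
  unfolding moment_comb_def altsum_def sum_distrib_left sum.distrib[symmetric]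
proof (intro sum.cong refl)
  fix j
  have "(x\<^sup>2) ^ j = x ^ (2 * j)" by (simp add: power_mult)
  thus "real (N choose j) * (-1) ^ j * (a j * x ^ (2 * j + 3) + b j * x ^ (2 * j + 2) + c j * x ^ (2 * j + 1)) =
    x ^ 3 * (real (N choose j) * (-1) ^ j * a j * (x\<^sup>2) ^ j) +
    x\<^sup>2 * (real (N choose j) * (-1) ^ j * b j * (x\<^sup>2) ^ j) +
    x * (real (N choose j) * (-1) ^ j * c j * (x\<^sup>2) ^ j)"
    by (simp only: power_add power_one_right) (simp add: algebra_simps)
qed

text \<open>On \<open>[-1, 1]\<close> the polynomials that \<open>moment_comb\<close> integrates against \<open>\<nu>\<^sup>\<omega>\<close> tend boundedly to \<open>c 0\<close> times
  the indicator of 0, so only the atom \<open>\<gamma> \<delta>(0)\<close> survives.\<close>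

lemma moment_comb_ptilde:
  assumes cub: "cubic a" "cubic b" "cubic c"
  obtains B where
    "\<And>N \<omega>. \<omega> \<in> Thoma_simplex \<Longrightarrow> \<bar>moment_comb a b c N (\<lambda>n. ptilde n \<omega>)\<bar> \<le> B"
    "\<And>\<omega>. \<omega> \<in> Thoma_simplex \<Longrightarrow>
       (\<lambda>N. moment_comb a b c N (\<lambda>n. ptilde n \<omega>)) \<longlonglongrightarrow> c 0 * th_gamma \<omega>"
proof -
  define H where "H N x = moment_comb a b c N (\<lambda>n. x ^ n)" for N and x :: real
  obtain Ba where Ba: "Ba \<ge> 0" "\<And>N y. 0 \<le> y \<Longrightarrow> y \<le> 1 \<Longrightarrow> \<bar>altsum N a y\<bar> \<le> Ba"
    using altsum_cubic_bounded[OF cub(1)] by blast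
  obtain Bb where Bb: "Bb \<ge> 0" "\<And>N y. 0 \<le> y \<Longrightarrow> y \<le> 1 \<Longrightarrow> \<bar>altsum N b y\<bar> \<le> Bb"
    using altsum_cubic_bounded[OF cub(2)] by blast
  obtain Bc where Bc: "Bc \<ge> 0" "\<And>N y. 0 \<le> y \<Longrightarrow> y \<le> 1 \<Longrightarrow> \<bar>altsum N c y\<bar> \<le> Bc"
    using altsum_cubic_bounded[OF cub(3)] by blast
  define K where "K = Ba + Bb + Bc"
  have K: "K \<ge> 0" using Ba Bb Bc by (simp add: K_def)
  \<comment> \<open>A bound linear in x, uniform in \<open>N\<close>: summed over the atoms, it is
    controlled by their total mass.\<close>
  have H_bound: "\<bar>H N x\<bar> \<le> K * \<bar>x\<bar>" if "\<bar>x\<bar> \<le> 1" for N x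
  proof -
    have x2: "0 \<le> x\<^sup>2" "x\<^sup>2 \<le> 1" using that by (simp_all add: abs_square_le_1)
    have p: "\<bar>x\<bar> ^ n \<le> \<bar>x\<bar>" if "n \<ge> 1" for n
      using power_decreasing[OF that, of "\<bar>x\<bar>"] \<open>\<bar>x\<bar> \<le> 1\<close> by simp
    have "\<bar>x ^ 3 * altsum N a (x\<^sup>2)\<bar> \<le> \<bar>x\<bar> * Ba"
      unfolding abs_mult power_abs using Ba x2 p by (intro mult_mono) auto
    moreover have "\<bar>x\<^sup>2 * altsum N b (x\<^sup>2)\<bar> \<le> \<bar>x\<bar> * Bb"
      unfolding abs_mult power_abs using Bb x2 p[of 2] by (intro mult_mono) auto
    moreover have "\<bar>x * altsum N c (x\<^sup>2)\<bar> \<le> \<bar>x\<bar> * Bc"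
      unfolding abs_mult using Bc x2 by (intro mult_mono) auto
    ultimately show ?thesis
      unfolding H_def moment_comb_power K_def mult.commute[of _ "\<bar>x\<bar>"] distrib_left by linarith
  qed
  \<comment> \<open>The origin is harmless because of the factor x in \<open>H\<close>; the value of
    L f at 0 enters only through \<gamma>.\<close>
  have H_limit: "(\<lambda>N. H N x) \<longlonglongrightarrow> 0" if "\<bar>x\<bar> \<le> 1" for x
  proof (cases "x = 0")
    case False
    have x2: "0 < x\<^sup>2" "x\<^sup>2 \<le> 1" using that False by (simp_all add: abs_square_le_1)
    have "(\<lambda>N. H N x) \<longlonglongrightarrow> x ^ 3 * 0 + x\<^sup>2 * 0 + x * 0"
      unfolding H_def moment_comb_power by (intro tendsto_intros altsum_cubic_limit_0 cub x2)
    thus ?thesis by simp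
  qed (simp add: H_def moment_comb_power)
  have eq: "moment_comb a b c N (\<lambda>n. ptilde n \<omega>) =
      (\<Sum>i. H N (th_alpha \<omega> i) - H N (- th_beta \<omega> i)) + c 0 * th_gamma \<omega>"
    if \<omega>: "\<omega> \<in> Thoma_simplex" for N \<omega>
  proof -
    define u where "u = (\<lambda>n i. th_alpha \<omega> i ^ n - (- th_beta \<omega> i) ^ n)"
    define w where "w j = real (N choose j) * (-1) ^ j" for j
    have su: "summable (u n)" if "n \<ge> 1" for n
      using ptilde_eq(1)[OF \<omega> that] by (simp add: u_def)
    have p: "ptilde n \<omega> = suminf (u n) + (if n = 1 then th_gamma \<omega> else 0)" if "n \<ge> 1" for n
      using ptilde_eq(2)[OF \<omega> that] by (simp add: u_def)
    have "H N (th_alpha \<omega> i) - H N (- th_beta \<omega> i) =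
        (\<Sum>j\<le>N. w j * (a j * u (2 * j + 3) i + b j * u (2 * j + 2) i + c j * u (2 * j + 1) i))" for i
      unfolding H_def moment_comb_def sum_subtractf[symmetric]
      by (intro sum.cong) (simp_all add: w_def u_def algebra_simps)
    hence "(\<Sum>i. H N (th_alpha \<omega> i) - H N (- th_beta \<omega> i)) =
        (\<Sum>i. \<Sum>j\<le>N. w j * (a j * u (2 * j + 3) i + b j * u (2 * j + 2) i + c j * u (2 * j + 1) i))"
      by simp
    also have "\<dots> = (\<Sum>j\<le>N. \<Sum>i. w j * (a j * u (2 * j + 3) i + b j * u (2 * j + 2) i + c j * u (2 * j + 1) i))"
      by (intro suminf_sum summable_mult summable_add su) auto
    also have "\<dots> = (\<Sum>j\<le>N. w j * (a j * suminf (u (2 * j + 3)) + b j * suminf (u (2 * j + 2)) +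
        c j * suminf (u (2 * j + 1))))"
    proof (intro sum.cong refl)
      fix j
      have "(\<lambda>i. w j * (a j * u (2 * j + 3) i + b j * u (2 * j + 2) i + c j * u (2 * j + 1) i)) sums
        (w j * (a j * suminf (u (2 * j + 3)) + b j * suminf (u (2 * j + 2)) +
        c j * suminf (u (2 * j + 1))))"
        by (intro sums_mult sums_add summable_sums su) auto
      thus "(\<Sum>i. w j * (a j * u (2 * j + 3) i + b j * u (2 * j + 2) i + c j * u (2 * j + 1) i)) =
        w j * (a j * suminf (u (2 * j + 3)) + b j * suminf (u (2 * j + 2)) +
        c j * suminf (u (2 * j + 1)))"
        by (rule sums_unique[symmetric])
    qed
    finally have "(\<Sum>i. H N (th_alpha \<omega> i) - H N (- th_beta \<omega> i)) + c 0 * th_gamma \<omega> =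
        (\<Sum>j\<le>N. w j * (a j * suminf (u (2 * j + 3)) + b j * suminf (u (2 * j + 2)) +
        c j * suminf (u (2 * j + 1)))) + c 0 * th_gamma \<omega>"
      by (simp only:)
    \<comment> \<open>Only \<open>ptilde 1\<close> contains \<gamma>, so its contribution is placed
      in the summand \<open>j = 0\<close>.\<close>
    also have "\<dots> = (\<Sum>j\<le>N. w j * (a j * suminf (u (2 * j + 3)) +
        b j * suminf (u (2 * j + 2)) + c j * suminf (u (2 * j + 1))) +
        (if j = 0 then c 0 * th_gamma \<omega> else 0))"
      by (simp only: sum.distrib) (simp only: sum.delta finite_atMost atMost_iff le0 if_True)
    also have "\<dots> = moment_comb a b c N (\<lambda>n. ptilde n \<omega>)"
      unfolding moment_comb_def
    proof (intro sum.cong refl)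
      fix j
      have "ptilde (2 * j + 3) \<omega> = suminf (u (2 * j + 3))" "ptilde (2 * j + 2) \<omega> = suminf (u (2 * j + 2))"
        "ptilde (2 * j + 1) \<omega> = suminf (u (2 * j + 1)) + (if j = 0 then th_gamma \<omega> else 0)"
        by (subst p; simp)+
      thus "w j * (a j * suminf (u (2 * j + 3)) + b j * suminf (u (2 * j + 2)) + c j * suminf (u (2 * j + 1))) +
          (if j = 0 then c 0 * th_gamma \<omega> else 0) = real (N choose j) * (-1) ^ j *
          (a j * ptilde (2 * j + 3) \<omega> + b j * ptilde (2 * j + 2) \<omega> + c j * ptilde (2 * j + 1) \<omega>)"
        by (cases "j = 0") (simp_all only: w_def if_True if_False simp_thms, simp_all add: distrib_left)
    qed
    finally show ?thesis ..
  qed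
  have term_bound: "\<bar>H N (th_alpha \<omega> i) - H N (- th_beta \<omega> i)\<bar> \<le> K * (th_alpha \<omega> i + th_beta \<omega> i)"
    if \<omega>: "\<omega> \<in> Thoma_simplex" for N \<omega> i
    using H_bound[of "th_alpha \<omega> i" N] H_bound[of "- th_beta \<omega> i" N] Thoma_simplexD[OF \<omega>]
    by (simp add: distrib_left)
  have dom: "summable (\<lambda>i. K * (th_alpha \<omega> i + th_beta \<omega> i))" if "\<omega> \<in> Thoma_simplex" for \<omega>
    using Thoma_simplexD[OF that] by (intro summable_mult summable_add)
  show ?thesis
  proof (rule that)
    fix N \<omega> assume \<omega>: "\<omega> \<in> Thoma_simplex"
    note D = Thoma_simplexD[OF \<omega>]
    have abs: "summable (\<lambda>i. \<bar>H N (th_alpha \<omega> i) - H N (- th_beta \<omega> i)\<bar>)"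
      using term_bound[OF \<omega>] by (intro summable_comparison_test'[OF dom[OF \<omega>], of 0]) simp
    have "\<bar>\<Sum>i. H N (th_alpha \<omega> i) - H N (- th_beta \<omega> i)\<bar> \<le> (\<Sum>i. K * (th_alpha \<omega> i + th_beta \<omega> i))"
      by (intro order_trans[OF summable_rabs[OF abs]] suminf_le abs dom \<omega> term_bound)
    also have "\<dots> = K * (suminf (th_alpha \<omega>) + suminf (th_beta \<omega>))"
      using D by (simp add: suminf_mult suminf_add summable_add)
    also have "\<dots> \<le> K * 1"
      using D(3,6) K by (intro mult_left_mono) linarith+
    finally have "\<bar>\<Sum>i. H N (th_alpha \<omega> i) - H N (- th_beta \<omega> i)\<bar> \<le> K" by simp
    moreover have "\<bar>c 0 * th_gamma \<omega>\<bar> \<le> \<bar>c 0\<bar>"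
    proof -
      have "suminf (th_alpha \<omega>) \<ge> 0" "suminf (th_beta \<omega>) \<ge> 0"
        using D by (auto intro!: suminf_nonneg)
      hence "\<bar>th_gamma \<omega>\<bar> \<le> 1" using D(3,6) by linarith
      thus ?thesis by (simp add: abs_mult mult_left_le)
    qed
    ultimately show "\<bar>moment_comb a b c N (\<lambda>n. ptilde n \<omega>)\<bar> \<le> K + \<bar>c 0\<bar>"
      unfolding eq[OF \<omega>] by linarith
  next
    fix \<omega> assume \<omega>: "\<omega> \<in> Thoma_simplex"
    note D = Thoma_simplexD[OF \<omega>]
    have "(\<lambda>N. \<Sum>i. H N (th_alpha \<omega> i) - H N (- th_beta \<omega> i)) \<longlonglongrightarrow> (\<Sum>i. 0 - 0)"
    \<comment> \<open>Dominated convergence for series, with the summable majorant supplied by the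
      linear bound.\<close>
    proof (rule conjunct2[OF conjunct2[OF tannerys_theorem]])
      show "(\<lambda>N. H N (th_alpha \<omega> i) - H N (- th_beta \<omega> i)) \<longlonglongrightarrow> 0 - 0" for i
        using D by (intro tendsto_diff H_limit) auto
      show "summable (\<lambda>i. K * (th_alpha \<omega> i + th_beta \<omega> i))" by (rule dom[OF \<omega>])
    qed (use term_bound[OF \<omega>] in \<open>auto intro!: always_eventually\<close>)
    hence "(\<lambda>N. (\<Sum>i. H N (th_alpha \<omega> i) - H N (- th_beta \<omega> i)) + c 0 * th_gamma \<omega>)
        \<longlonglongrightarrow> (\<Sum>i::nat. 0 - 0) + c 0 * th_gamma \<omega>"
      by (intro tendsto_add tendsto_const)
    thus "(\<lambda>N. moment_comb a b c N (\<lambda>n. ptilde n \<omega>)) \<longlonglongrightarrow> c 0 * th_gamma \<omega>"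
      by (simp add: eq[OF \<omega>])
  qed
qed

section \<open>Measurability on the Thoma simplex\<close>

lemma space_Thoma_borel: "space Thoma_borel = Thoma_simplex"
  and sets_Thoma_borelI: "openin Thoma_topology U \<Longrightarrow> U \<in> sets Thoma_borel"
proof -
  have sub: "{U. openin Thoma_topology U} \<subseteq> Pow (topspace Thoma_topology)"
    using openin_subset by blast
  show "space Thoma_borel = Thoma_simplex"
    unfolding Thoma_borel_def by (simp add: space_measure_of_conv Thoma_topology_def topspace_pullback_topology)
  show "openin Thoma_topology U \<Longrightarrow> U \<in> sets Thoma_borel"
    unfolding Thoma_borel_def sets_measure_of[OF sub] by blast
qed

lemma borel_measurable_Thoma_continuous:
  fixes f :: "(nat \<Rightarrow> real) \<times> (nat \<Rightarrow> real) \<Rightarrow> real"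
  assumes "continuous_on UNIV f"
  shows "(\<lambda>\<omega>. f (th_alpha \<omega>, th_beta \<omega>)) \<in> borel_measurable Thoma_borel"
proof (rule borel_measurableI)
  fix S :: "real set" assume "open S"
  hence "open (f -` S)" by (rule open_vimage[OF _ assms])
  hence "openin Thoma_topology ((\<lambda>\<omega>. (th_alpha \<omega>, th_beta \<omega>)) -` (f -` S) \<inter> Thoma_simplex)"
    unfolding Thoma_topology_def openin_pullback_topology open_openin[symmetric] by blast
  moreover have "(\<lambda>\<omega>. (th_alpha \<omega>, th_beta \<omega>)) -` (f -` S) \<inter> Thoma_simplex =
      (\<lambda>\<omega>. f (th_alpha \<omega>, th_beta \<omega>)) -` S \<inter> space Thoma_borel"
    by (auto simp: space_Thoma_borel)
  ultimately show "(\<lambda>\<omega>. f (th_alpha \<omega>, th_beta \<omega>)) -` S \<inter> space Thoma_borel \<in> sets Thoma_borel"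
    using sets_Thoma_borelI by metis
qed

lemma borel_measurable_th_alpha: "(\<lambda>\<omega>. th_alpha \<omega> i) \<in> borel_measurable Thoma_borel"
  and borel_measurable_th_beta: "(\<lambda>\<omega>. th_beta \<omega> i) \<in> borel_measurable Thoma_borel"
proof -
  have "continuous_on UNIV (\<lambda>p :: (nat \<Rightarrow> real) \<times> (nat \<Rightarrow> real). fst p i)"
    "continuous_on UNIV (\<lambda>p :: (nat \<Rightarrow> real) \<times> (nat \<Rightarrow> real). snd p i)"
    by (rule continuous_on_product_then_coordinatewise, intro continuous_intros)+
  thus "(\<lambda>\<omega>. th_alpha \<omega> i) \<in> borel_measurable Thoma_borel"
    "(\<lambda>\<omega>. th_beta \<omega> i) \<in> borel_measurable Thoma_borel"
    by (auto dest: borel_measurable_Thoma_continuous)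
qed

text \<open>\<gamma> is not continuous in this topology, since many small \<alpha>'s can escape to
  0, but it is 1 minus a countable sum of measurable coordinates.\<close>

lemma borel_measurable_th_gamma: "th_gamma \<in> borel_measurable Thoma_borel"
proof -
  have "(\<lambda>\<omega>. 1 - (\<Sum>i. th_alpha \<omega> i + th_beta \<omega> i)) \<in> borel_measurable Thoma_borel"
    by (intro borel_measurable_diff borel_measurable_suminf borel_measurable_add
        borel_measurable_th_alpha borel_measurable_th_beta borel_measurable_const)
  also have "?this \<longleftrightarrow> ?thesis"
    by (rule measurable_cong) (auto simp: space_Thoma_borel Thoma_simplex_def dest: sums_unique)
  finally show ?thesis .
qed

text \<open>A class closed under sums and products, which carries integrability from
  \<open>ptilde\<close> to the determinants \<open>stilde\<close>.\<close>

definition bdd_measurable :: "'a measure \<Rightarrow> ('a \<Rightarrow> real) \<Rightarrow> bool" where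
  "bdd_measurable M f \<longleftrightarrow> f \<in> borel_measurable M \<and> (\<exists>B. \<forall>x\<in>space M. \<bar>f x\<bar> \<le> B)"

lemma bdd_measurableI:
  "f \<in> borel_measurable M \<Longrightarrow> (\<And>x. x \<in> space M \<Longrightarrow> \<bar>f x\<bar> \<le> B) \<Longrightarrow> bdd_measurable M f"
  unfolding bdd_measurable_def by blast

lemma bdd_measurable_const: "bdd_measurable M (\<lambda>_. c)"
  by (rule bdd_measurableI[where B = "\<bar>c\<bar>"]) auto

lemma bdd_measurable_add:
  assumes "bdd_measurable M f" "bdd_measurable M g"
  shows "bdd_measurable M (\<lambda>x. f x + g x)"
proof -
  obtain B C where "\<forall>x\<in>space M. \<bar>f x\<bar> \<le> B" "\<forall>x\<in>space M. \<bar>g x\<bar> \<le> C"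
    using assms unfolding bdd_measurable_def by blast
  thus ?thesis using assms unfolding bdd_measurable_def
    by (intro conjI exI[of _ "B + C"] borel_measurable_add) (auto intro: order_trans[OF abs_triangle_ineq] add_mono)
qed

lemma bdd_measurable_mult:
  assumes "bdd_measurable M f" "bdd_measurable M g"
  shows "bdd_measurable M (\<lambda>x. f x * g x)"
proof -
  obtain B C where "\<forall>x\<in>space M. \<bar>f x\<bar> \<le> B" "\<forall>x\<in>space M. \<bar>g x\<bar> \<le> C"
    using assms unfolding bdd_measurable_def by blast
  hence "\<forall>x\<in>space M. \<bar>f x * g x\<bar> \<le> \<bar>B\<bar> * \<bar>C\<bar>"
    by (force simp: abs_mult intro!: mult_mono)
  thus ?thesis using assms unfolding bdd_measurable_def by (blast intro: borel_measurable_times)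
qed

lemma bdd_measurable_sum:
  "(\<And>i. i \<in> I \<Longrightarrow> bdd_measurable M (f i)) \<Longrightarrow> bdd_measurable M (\<lambda>x. \<Sum>i\<in>I. f i x)"
  by (induction I rule: infinite_finite_induct) (auto intro: bdd_measurable_const bdd_measurable_add)

lemma bdd_measurable_prod:
  "(\<And>i. i \<in> I \<Longrightarrow> bdd_measurable M (f i)) \<Longrightarrow> bdd_measurable M (\<lambda>x. \<Prod>i\<in>I. f i x)"
  by (induction I rule: infinite_finite_induct) (auto intro: bdd_measurable_const bdd_measurable_mult)

lemma bdd_measurable_prod_list:
  "(\<And>i. i \<in> set xs \<Longrightarrow> bdd_measurable M (f i)) \<Longrightarrow> bdd_measurable M (\<lambda>x. prod_list (map (\<lambda>i. f i x) xs))"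
  by (induction xs) (auto intro: bdd_measurable_const bdd_measurable_mult)

lemma (in finite_measure) bdd_measurable_imp_integrable:
  assumes "bdd_measurable M f"
  shows "integrable M f"
proof -
  obtain B where "f \<in> borel_measurable M" "\<forall>x\<in>space M. \<bar>f x\<bar> \<le> B"
    using assms unfolding bdd_measurable_def by blast
  thus ?thesis by (intro integrable_const_bound[where B = B] AE_I2) auto
qed

lemma bdd_measurable_ptilde:
  assumes "n \<ge> 1"
  shows "bdd_measurable Thoma_borel (ptilde n)"
proof (rule bdd_measurableI[where B = 1])
  have "(\<lambda>\<omega>. if n = 1 then 1 else
     (\<Sum>i. th_alpha \<omega> i ^ n) + (-1) ^ (n - 1) * (\<Sum>i. th_beta \<omega> i ^ n)) \<in> borel_measurable Thoma_borel"
    by (cases "n = 1") (auto intro!: borel_measurable_add borel_measurable_times borel_measurable_suminf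
        borel_measurable_power borel_measurable_th_alpha borel_measurable_th_beta)
  thus "ptilde n \<in> borel_measurable Thoma_borel" by (simp add: ptilde_def[abs_def])
qed (use assms abs_ptilde_le_1 in \<open>auto simp: space_Thoma_borel\<close>)

lemma bdd_measurable_htilde: "bdd_measurable Thoma_borel (htilde n)"
  unfolding htilde_def[abs_def] divide_inverse
proof (intro bdd_measurable_sum bdd_measurable_mult bdd_measurable_const bdd_measurable_prod_list bdd_measurable_ptilde)
  fix xs i assume "xs \<in> partitions_of n" "i \<in> set xs"
  thus "1 \<le> i" by (cases i) (auto simp: partitions_of_def is_partition_def)
qed

lemma bdd_measurable_stilde: "bdd_measurable Thoma_borel (stilde lam)"
proof -
  have "bdd_measurable Thoma_borel (htilde_int k)" for k
    by (cases "k < 0") (auto simp: htilde_int_def[abs_def] intro: bdd_measurable_const bdd_measurable_htilde)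
  thus ?thesis
    unfolding stilde_def[abs_def]
    by (intro bdd_measurable_sum bdd_measurable_mult bdd_measurable_const bdd_measurable_prod)
qed

section \<open>The parameter \<open>\<gamma>\<close>\<close>

text \<open>For conjugate parameters t is the squared modulus, nonzero as 0 is an integer, and the
  squared difference is at most 0. For real ones, (m, m+1) omits 0, so the signs agree, and the
  difference is below 1 in modulus.\<close>

lemma admissible_real_parameters:
  assumes "admissible z z'"
  obtains t s D :: real where "z * z' = of_real t" "t > 0" "z + z' = of_real s"
    "(z - z')\<^sup>2 = of_real D" "D < 4"
proof (cases "z' = cnj z \<and> z \<notin> \<int>")
  case True
  hence "z \<noteq> 0" by auto
  show ?thesis
  proof (rule that)
    show "z * z' = of_real ((cmod z)\<^sup>2)" using True by (simp add: complex_norm_square del: of_real_power)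
    show "(cmod z)\<^sup>2 > 0" using \<open>z \<noteq> 0\<close> by simp
    show "z + z' = of_real (2 * Re z)" using True by (simp add: complex_add_cnj)
    show "(z - z')\<^sup>2 = of_real (- (2 * Im z)\<^sup>2)"
      using True by (simp add: complex_diff_cnj power_mult_distrib)
    show "- (2 * Im z)\<^sup>2 < 4" using zero_le_power2[of "2 * Im z"] by linarith
  qed
next
  case False
  hence *: "z \<in> \<real>" "z' \<in> \<real>" "\<exists>m::int. m < Re z \<and> Re z < m + 1 \<and> m < Re z' \<and> Re z' < m + 1"
    using assms unfolding admissible_def by argo+
  from *(3) obtain m :: int where "m < Re z" "Re z < real_of_int m + 1" "m < Re z'"
    "Re z' < real_of_int m + 1"
    by (elim exE conjE)
  note m = *(1,2) this
  define x y where "x = Re z" and "y = Re z'"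
  have z: "z = of_real x" "z' = of_real y" using m by (simp_all add: x_def y_def)
  have xy: "m < x" "x < m + 1" "m < y" "y < m + 1" using m by (simp_all add: x_def y_def)
  show ?thesis
  proof (rule that)
    show "z * z' = of_real (x * y)" "z + z' = of_real (x + y)" "(z - z')\<^sup>2 = of_real ((x - y)\<^sup>2)"
      by (simp_all add: z)
    show "x * y > 0"
    proof (cases "m \<ge> 0")
      case True
      hence "x > 0" "y > 0" using xy by linarith+
      thus ?thesis by simp
    next
      case False
      hence "real_of_int m + 1 \<le> 0" by linarith
      hence "x < 0" "y < 0" using xy by linarith+
      thus ?thesis by (rule mult_neg_neg)
    qed
    have "\<bar>x - y\<bar> < 1" using xy by linarith
    hence "(x - y)\<^sup>2 < 1" by (simp add: abs_square_less_1)
    thus "(x - y)\<^sup>2 < 4" by simp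
  qed
qed

theorem theorem6p1:
  fixes z z' :: complex and P :: "thoma measure"
  assumes "admissible z z'"
    and "prob_space P"
    and "sets P = sets Thoma_borel"
    and "\<And>lam. is_partition lam \<Longrightarrow>
           complex_of_real (\<integral>\<omega>. stilde lam \<omega> \<partial>P) = Mzz z z' lam / of_nat (dim_part lam)"
  shows "measure P Thoma_face0 = 1"
proof -
  interpret prob_space P by fact
  note mean_stilde = assms(4)
  have space: "space P = Thoma_simplex"
    using sets_eq_imp_space_eq[OF assms(3)] by (simp add: space_Thoma_borel)
  have meas: "borel_measurable P = borel_measurable Thoma_borel"
    by (rule measurable_cong_sets) (simp_all add: assms(3))
  have bdd: "bdd_measurable P f \<longleftrightarrow> bdd_measurable Thoma_borel f" for f
    by (simp add: bdd_measurable_def meas space space_Thoma_borel)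
  have int_stilde: "integrable P (stilde lam)" for lam
    by (intro bdd_measurable_imp_integrable) (simp add: bdd bdd_measurable_stilde)
  have int_ptilde: "integrable P (ptilde n)" if "n \<ge> 1" for n
    using bdd_measurable_ptilde[OF that] by (intro bdd_measurable_imp_integrable) (simp add: bdd)
  obtain t s D :: real where t: "z * z' = of_real t" "t > 0" and s: "z + z' = of_real s"
    and D: "(z - z')\<^sup>2 = of_real D" "D < 4"
    using admissible_real_parameters[OF assms(1)] by blast
  have poch: "pochhammer (z * z') n \<noteq> 0" for n
    using pochhammer_pos[of t n] t by (simp add: pochhammer_of_real)
  define q where "q n = (\<integral>\<omega>. ptilde n \<omega> \<partial>P)" for n
  have q: "complex_of_real (q n) = hook_sum z z' n / (pochhammer (z * z') n * fact n)" if n: "n \<ge> 1" for n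
  proof -
    have "q n = (\<integral>\<omega>. (\<Sum>k<n. (-1) ^ k * stilde ((n - k) # replicate k 1) \<omega>) \<partial>P)"
      unfolding q_def ptilde_eq_hook_stilde[OF n] ..
    also have "\<dots> = (\<Sum>k<n. (-1) ^ k * (\<integral>\<omega>. stilde ((n - k) # replicate k 1) \<omega> \<partial>P))"
      by (subst Bochner_Integration.integral_sum) (auto intro!: integrable_mult_right int_stilde)
    finally have "complex_of_real (q n) =
        (\<Sum>k<n. (-1) ^ k * complex_of_real (\<integral>\<omega>. stilde ((n - k) # replicate k 1) \<omega> \<partial>P))"
      by simp
    also have "\<dots> = (\<Sum>k<n. (-1) ^ k * (of_nat ((n - 1) choose k) *
        pochhammer (z - of_nat k) n * pochhammer (z' - of_nat k) n / (pochhammer (z * z') n * fact n)))"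
    proof (intro sum.cong refl)
      fix k assume "k \<in> {..<n}"
      hence k: "k < n" by simp
      have "sorted_wrt (\<ge>) (replicate k (1 :: nat))" by (induction k) auto
      hence "is_partition ((n - k) # replicate k 1)"
        using k by (auto simp: is_partition_def)
      from mean_stilde[OF this] show "(-1) ^ k * complex_of_real (\<integral>\<omega>. stilde ((n - k) # replicate k 1) \<omega> \<partial>P) =
        (-1) ^ k * (of_nat ((n - 1) choose k) *
        pochhammer (z - of_nat k) n * pochhammer (z' - of_nat k) n / (pochhammer (z * z') n * fact n))"
        by (simp only: Mzz_hook[OF k])
    qed
    also have "\<dots> = hook_sum z z' n / (pochhammer (z * z') n * fact n)"
      unfolding hook_sum_def sum_divide_distrib by (intro sum.cong) simp_all
    finally show ?thesis .
  qed
  \<comment> \<open>The parameters enter only through \<open>t\<close>, \<open>s\<close> and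
    \<open>D\<close>, so the complex recurrence descends to the reals. It starts at
    \<open>k = 1\<close> because the formula for \<open>q n\<close> is available from
    \<open>n = 1\<close> on.\<close>
  have q_rec: "(real k + 3) * (t + real k + 1) * (t + real k) * q (k + 2) =
      s * (2 * real k + 3) * (t + real k) * q (k + 1) + real k * ((real k + 1)\<^sup>2 - D) * q k"
    if k: "k \<ge> 1" for k
  proof -
    have "complex_of_real ((real k + 3) * (t + real k + 1) * (t + real k) * q (k + 2)) =
      complex_of_real (s * (2 * real k + 3) * (t + real k) * q (k + 1) + real k * ((real k + 1)\<^sup>2 - D) * q k)"
      using hook_mean_recurrence[of z z' k, OF poch] k unfolding t(1) s D(1) by (simp add: q t(1))
    thus ?thesis by (simp only: of_real_eq_iff)
  qed
  (* the coefficients of L applied to x^(2j+1) *)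
  define a where "a j = (let k = 2 * real j + 1 in (k + 3) * (t + k + 1) * (t + k))" for j
  define b where "b j = (let k = 2 * real j + 1 in - (s * (2 * k + 3) * (t + k)))" for j
  define c where "c j = (let k = 2 * real j + 1 in - (k * ((k + 1)\<^sup>2 - D)))" for j
  \<comment> \<open>The witnesses are the coefficients of 1, j, j^2, j^3 after substituting
    \<open>k = 2 * j + 1\<close>.\<close>
  have cub: "cubic a" "cubic b" "cubic c"
    by (rule cubicI[of _ "4 * (t + 1) * (t + 2)" "2 * (t + 1) * (t + 2) + 16 * t + 24" "8 * t + 28" 8]
        cubicI[of _ "- s * 5 * (t + 1)" "- s * (4 * t + 14)" "- s * 8" 0]
        cubicI[of _ "- (4 - D)" "- (16 - 2 * D)" "-20" "-8"],
        simp add: a_def b_def c_def Let_def power2_eq_square power3_eq_cube algebra_simps)+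
  have mean_comb: "(\<integral>\<omega>. moment_comb a b c N (\<lambda>n. ptilde n \<omega>) \<partial>P) = 0" for N
  proof -
    have "(\<integral>\<omega>. moment_comb a b c N (\<lambda>n. ptilde n \<omega>) \<partial>P) = moment_comb a b c N q"
      unfolding moment_comb_def q_def
      by (subst Bochner_Integration.integral_sum;
          simp add: int_ptilde Bochner_Integration.integral_add integrable_add)
    also have "\<dots> = 0"
      unfolding moment_comb_def
    proof (intro sum.neutral ballI)
      fix j
      \<comment> \<open>Since f is odd, the recurrence is used only at odd \<open>k\<close>, which
        is at least 1.\<close>
      have "a j * q (2 * j + 3) + b j * q (2 * j + 2) + c j * q (2 * j + 1) = 0"
        using q_rec[of "2 * j + 1"] by (simp add: a_def b_def c_def Let_def algebra_simps numeral_eq_Suc)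
      thus "real (N choose j) * (-1) ^ j * (a j * q (2 * j + 3) + b j * q (2 * j + 2) + c j * q (2 * j + 1)) = 0"
        by simp
    qed
    finally show ?thesis .
  qed
  obtain B where B: "\<And>N \<omega>. \<omega> \<in> Thoma_simplex \<Longrightarrow> \<bar>moment_comb a b c N (\<lambda>n. ptilde n \<omega>)\<bar> \<le> B"
    and lim: "\<And>\<omega>. \<omega> \<in> Thoma_simplex \<Longrightarrow>
       (\<lambda>N. moment_comb a b c N (\<lambda>n. ptilde n \<omega>)) \<longlonglongrightarrow> c 0 * th_gamma \<omega>"
    using moment_comb_ptilde[OF cub] by blast
  have gamma: "th_gamma \<in> borel_measurable P"
    by (simp add: meas borel_measurable_th_gamma)
  have "(\<lambda>N. \<integral>\<omega>. moment_comb a b c N (\<lambda>n. ptilde n \<omega>) \<partial>P) \<longlonglongrightarrow> (\<integral>\<omega>. c 0 * th_gamma \<omega> \<partial>P)"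
  proof (rule integral_dominated_convergence[where w = "\<lambda>_. B"])
    show "(\<lambda>\<omega>. moment_comb a b c N (\<lambda>n. ptilde n \<omega>)) \<in> borel_measurable P" for N
      unfolding moment_comb_def
      by (intro borel_measurable_sum borel_measurable_times borel_measurable_add borel_measurable_const
          borel_measurable_integrable int_ptilde) auto
  qed (use gamma B lim in \<open>auto simp: space\<close>)
  hence "(\<integral>\<omega>. c 0 * th_gamma \<omega> \<partial>P) = 0"
    unfolding mean_comb by (simp add: LIMSEQ_const_iff)
  \<comment> \<open>\<open>c 0 = D - 4\<close> is the value of L f at the origin.\<close>
  moreover have "c 0 \<noteq> 0" using D(2) by (simp add: c_def)
  ultimately have "(\<integral>\<omega>. th_gamma \<omega> \<partial>P) = 0" by simp
  moreover have "integrable P th_gamma"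
  proof (rule integrable_const_bound[where B = 1])
    show "AE \<omega> in P. norm (th_gamma \<omega>) \<le> 1"
    proof (rule AE_I2)
      fix \<omega> assume "\<omega> \<in> space P"
      note W = Thoma_simplexD[OF this[unfolded space]]
      have "suminf (th_alpha \<omega>) \<ge> 0" "suminf (th_beta \<omega>) \<ge> 0"
        using W by (auto intro!: suminf_nonneg)
      thus "norm (th_gamma \<omega>) \<le> 1" using W(3,6) by simp
    qed
  qed (rule gamma)
  \<comment> \<open>A nonnegative function with mean 0 vanishes almost everywhere.\<close>
  ultimately have "AE \<omega> in P. th_gamma \<omega> = 0"
    by (subst (asm) integral_nonneg_eq_0_iff_AE) (auto simp: space Thoma_simplexD(3))
  moreover have "{\<omega> \<in> space P. th_gamma \<omega> = 0} \<in> sets P"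
    using gamma by measurable
  ultimately have "prob {\<omega> \<in> space P. th_gamma \<omega> = 0} = 1"
    by (subst prob_Collect_eq_1)
  thus ?thesis by (simp add: Thoma_face0_def space)
qed

end
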